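(* Let $X$ be a Banach space with a basis. Then the following are equivalent: (a) $X$ is reflexive. (b) Every bounded strongly continuous semigroup of linear operators on $X$ is mean ergodic. (c) Every bounded uniformly continuous semigroup of linear operators on $X$ is mean ergodic.
   Context: A basis of a Banach space means a Schauder basis (a finite vector-space basis if the space is finite-dimensional). A strongly continuous semigroup on $X$ is a family $(T(t))_{t\ge 0}$ of bounded linear operators on $X$ with $T(0)=I$, $T(t+s)=T(t)T(s)$ for all $t,s\ge 0$, and $t\mapsto T(t)x$ continuous on $[0,\infty)$ for each $x\in X$. It is uniformly continuous if $t\mapsto T(t)$ is continuous for the operator norm (equivalently, its generator is a bounded operator), and bounded if $\sup_{t\ge 0}\|T(t)\|<\infty$. Its Cesàro means are $C(r)x:=\frac1r\int_0^r T(s)x\,ds$ for $x\in X$, $r>0$. The semigroup is called mean ergodic if $C(r)x$ converges in $X$ as $r\to\infty$ for every $x\in X$. *)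

theory Defs
  imports "HOL-Analysis.Analysis"
begin

text \<open>
  The scalar field is the field of real or of complex numbers. The class describes these two fields;
  the norm is then forced to be the usual absolute value, because it is multiplicative
  and compatible with the real scalars.
\<close>

class real_or_complex_field = real_normed_field +
  assumes real_or_complex:
    "(\<forall>z. \<exists>a. z = a *\<^sub>R 1) \<or>
     (\<exists>i. i * i = -1 \<and> (\<forall>z. \<exists>a b. z = a *\<^sub>R 1 + b *\<^sub>R i))"

instance real :: real_or_complex_field
proof
  show "(\<forall>z::real. \<exists>a. z = a *\<^sub>R 1) \<or>
     (\<exists>i::real. i * i = -1 \<and> (\<forall>z. \<exists>a b. z = a *\<^sub>R 1 + b *\<^sub>R i))"
    by auto
qed

instance complex :: real_or_complex_field
proof
  have "z = Re z *\<^sub>R 1 + Im z *\<^sub>R \<i>" for z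
    by (simp add: complex_eq_iff)
  then show "(\<forall>z::complex. \<exists>a. z = a *\<^sub>R 1) \<or>
     (\<exists>i::complex. i * i = -1 \<and> (\<forall>z. \<exists>a b. z = a *\<^sub>R 1 + b *\<^sub>R i))"
    using i_squared by blast
qed

text \<open>
  The class \<^class>\<open>banach\<close> provides the complete norm and the real scalar multiplication, which the
  multiplication by scalars from \<open>'k\<close> extends.
\<close>

locale banach_space_over = vector_space smul
  for smul :: "'k::real_or_complex_field \<Rightarrow> 'a::banach \<Rightarrow> 'a" +
  assumes smul_of_real: "smul (of_real r) x = r *\<^sub>R x"
    and norm_smul: "norm (smul c x) = norm c * norm x"

lemma banach_space_over_real: "banach_space_over ((*\<^sub>R) :: real \<Rightarrow> 'a::banach \<Rightarrow> 'a)"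
  by unfold_locales (simp_all add: algebra_simps)

lemma banach_space_over_complex: "banach_space_over ((*) :: complex \<Rightarrow> complex \<Rightarrow> complex)"
  by unfold_locales (simp_all add: algebra_simps norm_mult scaleR_conv_of_real)

definition schauder_basis ::
    "('k::real_or_complex_field \<Rightarrow> 'a::banach \<Rightarrow> 'a) \<Rightarrow> (nat \<Rightarrow> 'a) \<Rightarrow> bool" where
  "schauder_basis smul e \<longleftrightarrow> (\<forall>x. \<exists>!a :: nat \<Rightarrow> 'k. (\<lambda>n. smul (a n) (e n)) sums x)"

text \<open>
  A Schauder basis is indexed by all natural numbers, hence exists only in infinite-dimensional
  spaces; the first disjunct is the finite-dimensional case.
\<close>

definition has_basis :: "('k::real_or_complex_field \<Rightarrow> 'a::banach \<Rightarrow> 'a) \<Rightarrow> bool" where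
  "has_basis smul \<longleftrightarrow>
     (\<exists>B. finite_dimensional_vector_space smul B) \<or> (\<exists>e. schauder_basis smul e)"

definition dual_space ::
    "('k::real_or_complex_field \<Rightarrow> 'a::banach \<Rightarrow> 'a) \<Rightarrow> ('a \<Rightarrow> 'k) set" where
  "dual_space smul = {\<phi>. Vector_Spaces.linear smul (*) \<phi> \<and> bounded_linear \<phi>}"

text \<open>
  Elements of the bidual are functions on all of \<open>'a \<Rightarrow> 'k\<close>, of which only the values on the dual
  space matter; \<^const>\<open>onorm\<close> is the norm of the dual space.
\<close>

definition bidual_space ::
    "('k::real_or_complex_field \<Rightarrow> 'a::banach \<Rightarrow> 'a) \<Rightarrow> (('a \<Rightarrow> 'k) \<Rightarrow> 'k) set" where
  "bidual_space smul = {F.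
     (\<forall>\<phi>\<in>dual_space smul. \<forall>\<psi>\<in>dual_space smul. F (\<lambda>x. \<phi> x + \<psi> x) = F \<phi> + F \<psi>) \<and>
     (\<forall>c. \<forall>\<phi>\<in>dual_space smul. F (\<lambda>x. c * \<phi> x) = c * F \<phi>) \<and>
     (\<exists>M. \<forall>\<phi>\<in>dual_space smul. norm (F \<phi>) \<le> M * onorm \<phi>)}"

definition reflexive_space :: "('k::real_or_complex_field \<Rightarrow> 'a::banach \<Rightarrow> 'a) \<Rightarrow> bool" where
  "reflexive_space smul \<longleftrightarrow>
     (\<forall>F\<in>bidual_space smul. \<exists>x. \<forall>\<phi>\<in>dual_space smul. F \<phi> = \<phi> x)"

definition strongly_continuous_semigroup ::
    "('k::real_or_complex_field \<Rightarrow> 'a::banach \<Rightarrow> 'a) \<Rightarrow> (real \<Rightarrow> 'a \<Rightarrow>\<^sub>L 'a) \<Rightarrow> bool" where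
  "strongly_continuous_semigroup smul T \<longleftrightarrow>
     (\<forall>t\<ge>0. Vector_Spaces.linear smul smul (blinfun_apply (T t))) \<and>
     T 0 = id_blinfun \<and>
     (\<forall>t\<ge>0. \<forall>s\<ge>0. T (t + s) = T t o\<^sub>L T s) \<and>
     (\<forall>x. continuous_on {0..} (\<lambda>t. blinfun_apply (T t) x))"

definition uniformly_continuous_semigroup ::
    "('k::real_or_complex_field \<Rightarrow> 'a::banach \<Rightarrow> 'a) \<Rightarrow> (real \<Rightarrow> 'a \<Rightarrow>\<^sub>L 'a) \<Rightarrow> bool" where
  "uniformly_continuous_semigroup smul T \<longleftrightarrow>
     strongly_continuous_semigroup smul T \<and> continuous_on {0..} T"

definition bounded_semigroup :: "(real \<Rightarrow> 'a::banach \<Rightarrow>\<^sub>L 'a) \<Rightarrow> bool" where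
  "bounded_semigroup T \<longleftrightarrow> bounded (T ` {0..})"

definition cesaro_mean :: "(real \<Rightarrow> 'a::banach \<Rightarrow>\<^sub>L 'a) \<Rightarrow> real \<Rightarrow> 'a \<Rightarrow> 'a" where
  "cesaro_mean T r x = (1 / r) *\<^sub>R integral {0..r} (\<lambda>s. blinfun_apply (T s) x)"

definition mean_ergodic :: "(real \<Rightarrow> 'a::banach \<Rightarrow>\<^sub>L 'a) \<Rightarrow> bool" where
  "mean_ergodic T \<longleftrightarrow> (\<forall>x. \<exists>l. ((\<lambda>r. cesaro_mean T r x) \<longlongrightarrow> l) at_top)"

end

theory Submission
  imports Defs
begin

text \<open>
  On a reflexive space, a cluster point of the Cesaro means of \<open>x\<close> in the bidual is represented by
  a vector \<open>l\<close>; it is fixed by the semigroup, and by the Hahn--Banach theorem \<open>x - l\<close> belongs to the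
  closed subspace of vectors with null Cesaro means.

  Conversely, let the space be nonreflexive with a Schauder basis. Then there are uniformly bounded
  projections \<open>S\<^sub>n\<close> with \<open>S\<^sub>m S\<^sub>n = S\<^bsub>min m n\<^esub>\<close>, a bounded sequence \<open>u\<^sub>n\<close> in the range of
  \<open>S\<^bsub>n+1\<^esub> - S\<^sub>n\<close>, and a functional \<open>f\<close> with \<open>f u\<^sub>n = 1\<close>: if the basis is not shrinking, the \<open>S\<^sub>n\<close> are
  partial sum projections; otherwise they come from a modified basis, built from a bounded
  divergent series of multiples of basis vectors. The operators
  \<open>Q\<^sub>n x = x - S\<^sub>n x + f (S\<^sub>n x) u\<^sub>n\<close> satisfy \<open>Q\<^sub>m Q\<^sub>n = Q\<^bsub>max m n\<^esub>\<close> and preserve \<open>f\<close>, and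
  suitable infinite convex combinations of them form a bounded, uniformly continuous semigroup. It
  preserves \<open>f\<close>, although its only fixed vector is \<open>0\<close>; so it is not mean ergodic.
\<close>

section \<open>The scalar field\<close>

lemma real_or_complex_cases:
  obtains (real) "\<And>z::'k::real_or_complex_field. \<exists>a. z = of_real a"
  | (complex) i where "i * i = -1" "\<And>z::'k::real_or_complex_field. \<exists>a b. z = of_real a + of_real b * i"
  using real_or_complex[where 'a='k] by (force simp: scaleR_conv_of_real)

text \<open>Multiplication by the conjugate gives a^2 + b^2. The conjugate has norm at most |a| +
  |b|, and (|a| + |b|)^2 <= 2 (a^2 + b^2). The bound controls both coordinates without identifying
  the norm with the complex modulus.\<close>

lemma norm_Cartesian_ge:
  fixes i :: "'k::real_normed_field"
  assumes i: "i * i = -1"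
  shows "\<bar>a\<bar> + \<bar>b\<bar> \<le> 2 * norm (of_real a + of_real b * i)"
proof (cases "a = 0 \<and> b = 0")
  case False
  let ?z = "of_real a + of_real b * i" and ?w = "of_real a - of_real b * i"
  let ?s = "\<bar>a\<bar> + \<bar>b\<bar>"
  have "norm i * norm i = 1"
    by (metis i norm_minus_cancel norm_mult norm_one)
  then have ni: "norm i = 1"
    by (metis abs_norm_cancel real_sqrt_abs2 real_sqrt_one)
  have "?z * ?w = of_real (a * a) - of_real (b * b) * (i * i)"
    by (simp add: algebra_simps)
  also have "\<dots> = of_real (a * a + b * b)"
    by (simp add: i)
  finally have "norm ?z * norm ?w = \<bar>a * a + b * b\<bar>"
    by (metis norm_mult norm_of_real)
  then have eq: "norm ?z * norm ?w = a * a + b * b"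
    by simp
  have "norm ?w \<le> ?s"
    using norm_triangle_ineq4[of "of_real a :: 'k" "of_real b * i"] by (simp add: norm_mult ni)
  then have "a * a + b * b \<le> norm ?z * ?s"
    unfolding eq[symmetric] by (rule mult_left_mono) simp
  moreover have "?s * ?s \<le> 2 * (a * a + b * b)"
  proof -
    have "0 \<le> (\<bar>a\<bar> - \<bar>b\<bar>)\<^sup>2" by simp
    then show ?thesis by (simp add: power2_eq_square algebra_simps)
  qed
  ultimately have "?s * ?s \<le> (2 * norm ?z) * ?s" by simp
  moreover have "?s > 0" using False by auto
  ultimately show ?thesis by (simp only: mult_le_cancel_right_pos)
qed simp

text \<open>Compact balls of scalars are needed for the limit point in the bidual, and the
  completeness that they entail for summing series of coefficients.\<close>

instance real_or_complex_field \<subseteq> heine_borel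
proof
  fix f :: "nat \<Rightarrow> 'a"
  assume "bounded (range f)"
  then obtain M where M: "\<And>n. norm (f n) \<le> M"
    by (auto simp: bounded_iff)
  show "\<exists>l r. strict_mono (r::nat\<Rightarrow>nat) \<and> (f \<circ> r) \<longlonglongrightarrow> l"
  proof (cases rule: real_or_complex_cases[where 'k='a])
    case real
    then have "\<forall>n. \<exists>a. f n = of_real a" by blast
    then obtain a where a: "\<And>n. f n = of_real (a n)" by metis
    have "bounded (range a)" using M by (auto simp: bounded_iff a)
    then obtain l r where r: "strict_mono (r::nat\<Rightarrow>nat)" and l: "(a \<circ> r) \<longlonglongrightarrow> l"
      using bounded_imp_convergent_subsequence by blast
    have "(f \<circ> r) \<longlonglongrightarrow> of_real l" using tendsto_of_real[OF l] by (simp add: o_def a)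
    with r show ?thesis by blast
  next
    case (complex i)
    then have "\<forall>n. \<exists>a b. f n = of_real a + of_real b * i" by blast
    then obtain a b where ab: "\<And>n. f n = of_real (a n) + of_real (b n) * i" by metis
    have "norm (Complex (a n) (b n)) \<le> 2 * M" for n
      using norm_Cartesian_ge[OF complex(1), of "a n" "b n"] M[of n]
        cmod_le[of "Complex (a n) (b n)"] by (simp add: ab)
    then have "bounded (range (\<lambda>n. Complex (a n) (b n)))" by (auto simp: bounded_iff)
    then obtain l r where r: "strict_mono (r::nat\<Rightarrow>nat)"
      and l: "((\<lambda>n. Complex (a n) (b n)) \<circ> r) \<longlonglongrightarrow> l"
      using bounded_imp_convergent_subsequence by blast
    have "(\<lambda>n. a (r n)) \<longlonglongrightarrow> Re l" "(\<lambda>n. b (r n)) \<longlonglongrightarrow> Im l"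
      using tendsto_Re[OF l] tendsto_Im[OF l] by (simp_all add: o_def)
    then have "(\<lambda>n. of_real (a (r n)) + of_real (b (r n)) * i)
        \<longlonglongrightarrow> of_real (Re l) + of_real (Im l) * i"
      by (intro tendsto_intros)
    with r show ?thesis by (auto simp: o_def ab)
  qed
qed

instance real_or_complex_field \<subseteq> banach ..


section \<open>The Hahn--Banach theorem\<close>

definition sublinear :: "('a::real_vector \<Rightarrow> real) \<Rightarrow> bool" where
  "sublinear p \<longleftrightarrow> (\<forall>x y. p (x + y) \<le> p x + p y) \<and> (\<forall>c\<ge>0. \<forall>x. p (c *\<^sub>R x) = c * p x)"

lemma sublinear_add: "sublinear p \<Longrightarrow> p (x + y) \<le> p x + p y"
  and sublinear_scaleR: "sublinear p \<Longrightarrow> c \<ge> 0 \<Longrightarrow> p (c *\<^sub>R x) = c * p x"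
  by (auto simp: sublinear_def)

lemma sublinear_0: "sublinear p \<Longrightarrow> p 0 = 0"
  using sublinear_scaleR[of p 0 0] by simp

lemma sublinear_ge: "sublinear p \<Longrightarrow> - p (- x) \<le> p x"
  using sublinear_add[of p x "-x"] sublinear_0[of p] by simp

text \<open>Applying \<open>scale\<close> with the inverse factor gives the reverse inequality, so
  one inequality for positive factors suffices.\<close>

lemma sublinearI:
  assumes add: "\<And>x y. p (x + y) \<le> p x + p y" and zero: "p 0 = 0"
    and scale: "\<And>c x. c > 0 \<Longrightarrow> p (c *\<^sub>R x) \<le> c * p x"
  shows "sublinear p"
proof -
  have "p (c *\<^sub>R x) = c * p x" if "c > 0" for c x
  proof (rule antisym)
    have "p x \<le> inverse c * p (c *\<^sub>R x)" using scale[of "inverse c" "c *\<^sub>R x"] that by simp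
    then show "c * p x \<le> p (c *\<^sub>R x)" using that by (simp add: field_simps)
  qed (rule scale[OF that])
  then have "p (c *\<^sub>R x) = c * p x" if "c \<ge> 0" for c x
    using that zero by (cases "c = 0") auto
  with add show ?thesis by (simp add: sublinear_def)
qed

text \<open>For sublinear \<open>p\<close>, this is the largest sublinear functional below
  \<open>p\<close> whose value at \<open>- y\<close> is at most \<open>- p y\<close>.\<close>

definition tilt :: "('a::real_vector \<Rightarrow> real) \<Rightarrow> 'a \<Rightarrow> 'a \<Rightarrow> real" where
  "tilt p y x = (INF t\<in>{0..}. p (x + t *\<^sub>R y) - t * p y)"

lemma tilt_bdd_below:
  assumes "sublinear p"
  shows "bdd_below ((\<lambda>t. p (x + t *\<^sub>R y) - t * p y) ` {0..})"
proof (rule bdd_belowI2)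
  fix t :: real assume "t \<in> {0..}"
  then have "t * p y \<le> p (x + t *\<^sub>R y) + p (- x)"
    using sublinear_add[OF assms, of "x + t *\<^sub>R y" "-x"] sublinear_scaleR[OF assms, of t y] by simp
  then show "- p (- x) \<le> p (x + t *\<^sub>R y) - t * p y" by simp
qed

lemma tilt_le: "sublinear p \<Longrightarrow> t \<ge> 0 \<Longrightarrow> tilt p y x \<le> p (x + t *\<^sub>R y) - t * p y"
  unfolding tilt_def by (rule cINF_lower[OF tilt_bdd_below]) auto

lemma tilt_greatest: "(\<And>t. t \<ge> 0 \<Longrightarrow> c \<le> p (x + t *\<^sub>R y) - t * p y) \<Longrightarrow> c \<le> tilt p y x"
  unfolding tilt_def by (rule cINF_greatest) auto

lemma sublinear_tilt:
  assumes p: "sublinear p"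
  shows "sublinear (tilt p y)"
proof (rule sublinearI)
  fix x1 x2
  have "tilt p y (x1 + x2) - (p (x2 + s *\<^sub>R y) - s * p y) \<le> tilt p y x1" if s: "s \<ge> 0" for s
  proof (rule tilt_greatest)
    fix t :: real assume t: "t \<ge> 0"
    have "tilt p y (x1 + x2) \<le> p (x1 + x2 + (t + s) *\<^sub>R y) - (t + s) * p y"
      by (rule tilt_le[OF p]) (use s t in simp)
    also have "x1 + x2 + (t + s) *\<^sub>R y = (x1 + t *\<^sub>R y) + (x2 + s *\<^sub>R y)"
      by (simp add: algebra_simps)
    also have "p \<dots> \<le> p (x1 + t *\<^sub>R y) + p (x2 + s *\<^sub>R y)" by (rule sublinear_add[OF p])
    finally show "tilt p y (x1 + x2) - (p (x2 + s *\<^sub>R y) - s * p y) \<le> p (x1 + t *\<^sub>R y) - t * p y"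
      by (simp add: algebra_simps)
  qed
  then have "tilt p y (x1 + x2) - tilt p y x1 \<le> tilt p y x2"
    by (intro tilt_greatest) (simp add: algebra_simps)
  then show "tilt p y (x1 + x2) \<le> tilt p y x1 + tilt p y x2" by simp
next
  show "tilt p y 0 = 0"
    using tilt_le[OF p, of 0 y 0] tilt_greatest[of 0 p 0 y]
    by (auto simp: sublinear_0[OF p] sublinear_scaleR[OF p])
next
  fix c :: real and x assume c: "c > 0"
  have "tilt p y (c *\<^sub>R x) / c \<le> tilt p y x"
  proof (rule tilt_greatest)
    fix t :: real assume t: "t \<ge> 0"
    have "tilt p y (c *\<^sub>R x) \<le> p (c *\<^sub>R x + (c * t) *\<^sub>R y) - c * t * p y"
      by (rule tilt_le[OF p]) (use c t in simp)
    also have "c *\<^sub>R x + (c * t) *\<^sub>R y = c *\<^sub>R (x + t *\<^sub>R y)" by (simp add: algebra_simps)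
    also have "p \<dots> = c * p (x + t *\<^sub>R y)" using c by (simp add: sublinear_scaleR[OF p])
    finally show "tilt p y (c *\<^sub>R x) / c \<le> p (x + t *\<^sub>R y) - t * p y"
      using c by (simp add: field_simps)
  qed
  then show "tilt p y (c *\<^sub>R x) \<le> c * tilt p y x" using c by (simp add: field_simps)
qed

lemma tilt_le_self: "sublinear p \<Longrightarrow> tilt p y x \<le> p x"
  using tilt_le[of p 0 y x] by simp

lemma tilt_uminus: "sublinear p \<Longrightarrow> tilt p y (- y) \<le> - p y"
  using tilt_le[of p 1 y "-y"] by (simp add: sublinear_0)

text \<open>Two members of a chain have a common lower bound in it, which gives subadditivity of the
  infimum; the lower bound \<open>- p (- x)\<close> keeps the infimum finite. This supplies the
  bounds that Zorn's lemma asks for.\<close>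

lemma sublinear_INF_chain:
  fixes C :: "('a::real_vector \<Rightarrow> real) set"
  assumes C: "C \<noteq> {}" and sub: "\<And>q. q \<in> C \<Longrightarrow> sublinear q"
    and le: "\<And>q. q \<in> C \<Longrightarrow> q \<le> p"
    and chain: "\<And>q r. q \<in> C \<Longrightarrow> r \<in> C \<Longrightarrow> q \<le> r \<or> r \<le> q"
  shows "sublinear (\<lambda>x. INF q\<in>C. q x)" "\<And>q x. q \<in> C \<Longrightarrow> (INF q\<in>C. q x) \<le> q x"
proof -
  let ?u = "\<lambda>x. INF q\<in>C. q x"
  have "bdd_below ((\<lambda>q. q x) ` C)" for x
  proof (rule bdd_belowI2)
    fix q assume "q \<in> C"
    then show "- p (- x) \<le> q x" using le_funD[OF le, of q "-x"] sublinear_ge[OF sub, of q x] by simp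
  qed
  then show lower: "?u x \<le> q x" if "q \<in> C" for q x
    using that by (intro cINF_lower)
  have greatest: "c \<le> ?u x" if "\<And>q. q \<in> C \<Longrightarrow> c \<le> q x" for c x
    using C that by (rule cINF_greatest)
  show "sublinear ?u"
  proof (rule sublinearI)
    fix x y
    have "?u (x + y) - q x \<le> r y" if qr: "q \<in> C" "r \<in> C" for q r
    proof -
      obtain w where "w \<in> C" "w \<le> q" "w \<le> r" using chain[OF qr] qr by auto
      then show ?thesis
        using lower[of w "x + y"] sublinear_add[OF sub, of w x y]
        by (smt (verit) le_funD)
    qed
    then have "?u (x + y) - ?u y \<le> q x" if "q \<in> C" for q
      using greatest[of "?u (x + y) - q x" y] that by force
    then show "?u (x + y) \<le> ?u x + ?u y"
      using greatest[of "?u (x + y) - ?u y" x] by force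
  next
    show "?u 0 = 0" using C sub by (simp add: sublinear_0)
  next
    fix c :: real and x assume c: "c > 0"
    have "?u (c *\<^sub>R x) / c \<le> ?u x"
    proof (rule greatest)
      fix q assume q: "q \<in> C"
      show "?u (c *\<^sub>R x) / c \<le> q x"
        using lower[OF q, of "c *\<^sub>R x"] sublinear_scaleR[OF sub[OF q], of c x] c
        by (simp add: field_simps)
    qed
    then show "?u (c *\<^sub>R x) \<le> c * ?u x" using c by (simp add: field_simps)
  qed
qed

text \<open>A minimal sublinear functional agrees with all its tilts, hence is odd and so linear.\<close>

theorem sublinear_dominates_linear:
  fixes p :: "'a::real_vector \<Rightarrow> real"
  assumes p: "sublinear p"
  obtains f where "linear f" "\<And>x. f x \<le> p x" "f a = p a"
proof -
  \<comment> \<open>Minimising below \<open>tilt p a\<close> instead of \<open>p\<close> forces the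
    value \<open>p a\<close> at \<open>a\<close>. The order is reversed because Zorn's lemma yields
    maximal elements.\<close>
  let ?A = "{q. sublinear q \<and> q \<le> tilt p a}"
  have po: "partial_order_on ?A (relation_of (\<ge>) ?A)"
    by (auto simp: partial_order_on_def preorder_on_def refl_on_def trans_def antisym_def relation_of_def)
  have "\<exists>m\<in>?A. \<forall>q\<in>?A. q \<le> m \<longrightarrow> q = m"
  proof (rule predicate_Zorn[OF po])
    fix C assume C: "C \<in> Chains (relation_of (\<ge>) ?A)"
    show "\<exists>u\<in>?A. \<forall>q\<in>C. u \<le> q"
    proof (cases "C = {}")
      case True
      then show ?thesis using sublinear_tilt[OF p] by auto
    next
      case False
      have sub: "sublinear q" and le: "q \<le> tilt p a" if "q \<in> C" for q
        using C that by (auto simp: Chains_def relation_of_def)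
      have chain: "q \<le> r \<or> r \<le> q" if "q \<in> C" "r \<in> C" for q r
        using C that by (auto simp: Chains_def relation_of_def)
      have inf: "sublinear (\<lambda>x. INF q\<in>C. q x)" "\<And>q x. q \<in> C \<Longrightarrow> (INF q\<in>C. q x) \<le> q x"
        using sublinear_INF_chain[of C "tilt p a"] False sub le chain by blast+
      obtain q where "q \<in> C" using False by blast
      have "(\<lambda>x. INF q\<in>C. q x) \<in> ?A"
        using inf(1) inf(2)[OF \<open>q \<in> C\<close>] le[OF \<open>q \<in> C\<close>] by (auto simp: le_fun_def intro: order_trans)
      then show ?thesis using inf(2) by (intro bexI[of _ "\<lambda>x. INF q\<in>C. q x"]) (auto simp: le_fun_def)
    qed
  qed
  then obtain f where f: "sublinear f" "f \<le> tilt p a"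
    and min: "\<And>q. sublinear q \<Longrightarrow> q \<le> f \<Longrightarrow> q = f"
    by (smt (verit) mem_Collect_eq order_trans)
  have odd: "f (- y) = - f y" for y
  proof -
    have "tilt f y = f"
      by (rule min[OF sublinear_tilt[OF f(1)]]) (simp add: le_fun_def tilt_le_self f(1))
    then show ?thesis using tilt_uminus[OF f(1), of y] sublinear_ge[OF f(1), of y] by simp
  qed
  have "linear f"
  proof (rule linearI)
    show "f (x + y) = f x + f y" for x y
      using sublinear_add[OF f(1), of x y] sublinear_add[OF f(1), of "-x" "-y"]
      by (simp add: odd odd[of "x + y", simplified])
    show "f (c *\<^sub>R x) = c *\<^sub>R f x" for c x
      using sublinear_scaleR[OF f(1), of c x] sublinear_scaleR[OF f(1), of "-c" x]
      by (cases "c \<ge> 0") (auto simp: odd)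
  qed
  moreover have le: "f x \<le> p x" for x
    using f(2) tilt_le_self[OF p] by (meson le_funD order_trans)
  moreover have "f a = p a"
  proof (rule antisym[OF le])
    have "f (- a) \<le> - p a" using f(2) tilt_uminus[OF p] by (meson le_funD order_trans)
    then show "p a \<le> f a" by (simp add: odd)
  qed
  ultimately show ?thesis by (rule that)
qed

section \<open>Functionals over the scalar field and the Hahn-Banach theorem for seminorms\<close>

context banach_space_over
begin

lemma smul_scaleR: "smul c (r *\<^sub>R x) = r *\<^sub>R smul c x"
  by (simp add: smul_of_real[symmetric] scale_left_commute)

lemma smul_of_real_mult: "smul (of_real r * c) x = r *\<^sub>R smul c x"
  by (simp add: smul_of_real[symmetric])

lemma bounded_linear_smul: "bounded_linear (smul c)"
  by (rule bounded_linear_intro[where K = "norm c"])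
    (simp_all add: scale_right_distrib smul_scaleR norm_smul mult.commute)

lemma bounded_linear_smul_left: "bounded_linear (\<lambda>c. smul c x)"
  by (rule bounded_linear_intro[where K = "norm x"])
    (simp_all add: scale_left_distrib scaleR_conv_of_real smul_of_real_mult norm_smul)

lemma vector_space_field: "vector_space ((*) :: 'k \<Rightarrow> 'k \<Rightarrow> 'k)"
  by unfold_locales (simp_all add: algebra_simps)

lemma linear_smul_iff:
  "Vector_Spaces.linear smul smul f \<longleftrightarrow>
    (\<forall>x y. f (x + y) = f x + f y) \<and> (\<forall>c x. f (smul c x) = smul c (f x))"
  using vector_space_axioms by (simp add: Vector_Spaces.linear_iff)

lemma dual_spaceI:
  assumes "\<And>x y. f (x + y) = f x + f y" "\<And>c x. f (smul c x) = c * f x"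
    and "\<And>x. norm (f x) \<le> norm x * K"
  shows "f \<in> dual_space smul"
proof -
  have "f (r *\<^sub>R x) = r *\<^sub>R f x" for r x
    using assms(2)[of "of_real r" x] by (simp add: smul_of_real scaleR_conv_of_real)
  then have "bounded_linear f"
    using assms by (intro bounded_linear_intro[where K = K])
  then show ?thesis
    using assms vector_space_axioms vector_space_field
    by (simp add: dual_space_def Vector_Spaces.linear_iff)
qed

lemma dual_space_add: "\<phi> \<in> dual_space smul \<Longrightarrow> \<phi> (x + y) = \<phi> x + \<phi> y"
  and dual_space_smul: "\<phi> \<in> dual_space smul \<Longrightarrow> \<phi> (smul c x) = c * \<phi> x"
  and dual_space_bounded_linear: "\<phi> \<in> dual_space smul \<Longrightarrow> bounded_linear \<phi>"
  by (auto simp: dual_space_def Vector_Spaces.linear_iff)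

lemma dual_space_diff: "\<phi> \<in> dual_space smul \<Longrightarrow> \<phi> (x - y) = \<phi> x - \<phi> y"
  and dual_space_0: "\<phi> \<in> dual_space smul \<Longrightarrow> \<phi> 0 = 0"
  using dual_space_bounded_linear linear_simps by blast+

lemma dual_space_compose:
  assumes "\<phi> \<in> dual_space smul" "Vector_Spaces.linear smul smul A" "bounded_linear A"
  shows "(\<lambda>x. \<phi> (A x)) \<in> dual_space smul"
  using assms vector_space_axioms vector_space_field
    bounded_linear_compose[OF dual_space_bounded_linear[OF assms(1)] assms(3)]
  by (simp add: dual_space_def Vector_Spaces.linear_iff)

lemma dual_space_plus:
  "\<phi> \<in> dual_space smul \<Longrightarrow> \<psi> \<in> dual_space smul \<Longrightarrow> (\<lambda>x. \<phi> x + \<psi> x) \<in> dual_space smul"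
  by (auto simp: dual_space_def Vector_Spaces.linear_iff algebra_simps intro: bounded_linear_add)

lemma dual_space_times: "\<phi> \<in> dual_space smul \<Longrightarrow> (\<lambda>x. c * \<phi> x) \<in> dual_space smul"
  by (auto simp: dual_space_def Vector_Spaces.linear_iff algebra_simps
      intro: bounded_linear_compose[OF bounded_linear_mult_right])

lemma dual_space_minus:
  assumes "\<phi> \<in> dual_space smul" "\<psi> \<in> dual_space smul"
  shows "(\<lambda>x. \<phi> x - \<psi> x) \<in> dual_space smul"
  using dual_space_plus[OF assms(1) dual_space_times[OF assms(2), of "-1"]] by simp

text \<open>Domination by the norm is included so that a functional bounded by a multiple of
  \<open>p\<close> is automatically continuous.\<close>

definition seminorm :: "('a \<Rightarrow> real) \<Rightarrow> bool" where
  "seminorm p \<longleftrightarrow> (\<forall>x y. p (x + y) \<le> p x + p y) \<and> (\<forall>c x. p (smul c x) = norm c * p x) \<and>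
     (\<forall>x. p x \<le> norm x)"

lemma seminorm_norm: "seminorm norm"
  by (simp add: seminorm_def norm_triangle_ineq norm_smul)

text \<open>The constant 4 absorbs the loss of working with the real and imaginary part separately.\<close>

theorem hahn_banach_seminorm:
  assumes "seminorm p"
  obtains \<phi> where "\<phi> \<in> dual_space smul" "\<And>x. norm (\<phi> x) \<le> 4 * p x" "\<phi> a = of_real (p a)"
proof -
  have add: "p (x + y) \<le> p x + p y" and scale: "p (smul c x) = norm c * p x"
    and le: "p x \<le> norm x" for c x y
    using assms by (auto simp: seminorm_def)
  have "sublinear p"
    using add scale[of "of_real _"] by (simp add: sublinear_def smul_of_real)
  then obtain f where f: "linear f" "\<And>x. f x \<le> p x" "f a = p a"
    using sublinear_dominates_linear[of p a] by blast
  interpret f: linear f by (rule f(1))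
  have uminus: "p (- x) = p x" for x
    using scale[of "-1" x] by simp
  have pos: "0 \<le> p x" for x
    using add[of x "-x"] uminus[of x] scale[of 0 x] by (simp add: scale_zero_left)
  have abs: "\<bar>f x\<bar> \<le> p x" for x
    using f(2)[of x] f(2)[of "-x"] by (simp add: f.neg uminus)
  show ?thesis
  proof (cases rule: real_or_complex_cases[where 'k='k])
    case real
    show ?thesis
    proof (rule that)
      show "(\<lambda>x. of_real (f x)) \<in> dual_space smul"
      proof (rule dual_spaceI)
        show "of_real (f (x + y)) = of_real (f x) + (of_real (f y) :: 'k)" for x y
          by (simp add: f.add)
        show "of_real (f (smul c x)) = c * of_real (f x)" for c x
        proof -
          obtain r where "c = of_real r" using real by blast
          then show ?thesis by (simp add: smul_of_real f.scale)
        qed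
        show "norm (of_real (f x) :: 'k) \<le> norm x * 1" for x
          using abs[of x] le[of x] by simp
      qed
      show "norm (of_real (f x) :: 'k) \<le> 4 * p x" for x
        using abs[of x] pos[of x] by simp
      show "of_real (f a) = (of_real (p a) :: 'k)"
        by (simp add: f(3))
    qed
  next
    case (complex i)
    \<comment> \<open>The usual complexification: \<open>f\<close> is the real part, and
      compatibility with multiplication by \<open>i\<close> forces the imaginary part.\<close>
    define g where "g x = of_real (f x) - of_real (f (smul i x)) * i" for x
    have gadd: "g (x + y) = g x + g y" for x y
      by (simp add: g_def f.add scale_right_distrib algebra_simps)
    have gR: "g (r *\<^sub>R x) = of_real r * g x" for r x
      by (simp add: g_def f.scale smul_scaleR algebra_simps)
    have ii: "smul i (smul i x) = - x" for x
      by (simp add: complex(1))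
    have gi: "g (smul i x) = i * g x" for x
    proof -
      have "i * g x = of_real (f x) * i - of_real (f (smul i x)) * (i * i)"
        by (simp add: g_def algebra_simps)
      then show ?thesis by (simp add: g_def ii f.neg complex(1))
    qed
    have gscale: "g (smul c x) = c * g x" for c x
    proof -
      obtain \<alpha> \<beta> where c: "c = of_real \<alpha> + of_real \<beta> * i" using complex(2) by blast
      have "smul c x = \<alpha> *\<^sub>R x + \<beta> *\<^sub>R smul i x"
        by (simp add: c scale_left_distrib smul_of_real smul_of_real_mult)
      then show ?thesis by (simp add: gadd gR gi c algebra_simps)
    qed
    have ni: "norm i = 1"
    proof -
      have "norm i * norm i = 1"
        by (metis complex(1) norm_minus_cancel norm_mult norm_one)
      then show ?thesis by (metis abs_norm_cancel real_sqrt_abs2 real_sqrt_one)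
    qed
    have gle: "norm (g x) \<le> 2 * p x" for x
    proof -
      have "norm (g x) \<le> \<bar>f x\<bar> + \<bar>f (smul i x)\<bar>"
        unfolding g_def by (rule order_trans[OF norm_triangle_ineq4]) (simp add: norm_mult ni)
      also have "\<dots> \<le> 2 * p x"
        using abs[of x] abs[of "smul i x"] by (simp add: scale ni)
      finally show ?thesis .
    qed
    have ga: "p a \<le> 2 * norm (g a)"
      using norm_Cartesian_ge[OF complex(1), of "f a" "- f (smul i a)"] pos[of a]
      by (simp add: g_def f(3))
    \<comment> \<open>Rescaling makes the value at \<open>a\<close> equal to \<open>p a\<close>. If
      \<open>g a = 0\<close>, then \<open>ga\<close> gives \<open>p a = 0\<close>, and division by
      zero yields \<open>s = 0\<close>, which still fits.\<close>
    define s where "s = of_real (p a) / g a"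
    have ns: "norm s \<le> 2"
      using ga pos[of a] by (cases "g a = 0") (auto simp: s_def norm_divide field_simps)
    have le4: "norm (s * g x) \<le> 4 * p x" for x
      using mult_mono[OF ns gle[of x]] by (simp add: norm_mult)
    show ?thesis
    proof (rule that)
      show "(\<lambda>x. s * g x) \<in> dual_space smul"
      proof (rule dual_spaceI)
        show "norm (s * g x) \<le> norm x * 4" for x
          using le4[of x] le[of x] by simp
      qed (simp_all add: gadd gscale algebra_simps)
      show "s * g a = of_real (p a)"
        using ga pos[of a] by (cases "g a = 0") (auto simp: s_def)
    qed (rule le4)
  qed
qed

text \<open>This is the quotient seminorm modulo the subspace \<open>N\<close>. Sums of points of
  \<open>N\<close> give subadditivity; scaling by a factor and by its inverse gives
  homogeneity.\<close>

lemma seminorm_infdist: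
  assumes N: "N \<noteq> {}" "\<And>x y. x \<in> N \<Longrightarrow> y \<in> N \<Longrightarrow> x + y \<in> N" "\<And>c x. x \<in> N \<Longrightarrow> smul c x \<in> N"
  shows "seminorm (\<lambda>x. infdist x N)"
proof -
  have greatest: "c \<le> infdist x N" if "\<And>n. n \<in> N \<Longrightarrow> c \<le> dist x n" for c x
    using N(1) that by (auto simp: infdist_def intro: cINF_greatest)
  have "0 \<in> N" using N(1) N(3)[of _ 0] by (auto simp: scale_zero_left)
  then have le: "infdist x N \<le> norm x" for x using infdist_le[of 0 N x] by simp
  have "infdist (x + y) N \<le> infdist x N + infdist y N" for x y
  proof -
    have "infdist (x + y) N \<le> dist x m + dist y n" if "m \<in> N" "n \<in> N" for m n
      using infdist_le[OF N(2)[OF that], of "x + y"] dist_triangle_add[of x y m n] by linarith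
    then have "infdist (x + y) N - dist x m \<le> infdist y N" if "m \<in> N" for m
      using that by (intro greatest) force
    then have "infdist (x + y) N - infdist y N \<le> infdist x N"
      by (intro greatest) force
    then show ?thesis by simp
  qed
  moreover have half: "infdist (smul c x) N \<le> norm c * infdist x N" if "c \<noteq> 0" for c x
  proof -
    have "infdist (smul c x) N / norm c \<le> infdist x N"
    proof (rule greatest)
      fix n assume "n \<in> N"
      then have "infdist (smul c x) N \<le> norm (smul c (x - n))"
        using infdist_le[OF N(3)[of n c], of "smul c x"] by (simp add: dist_norm scale_right_diff_distrib)
      then show "infdist (smul c x) N / norm c \<le> dist x n"
        using that unfolding norm_smul by (simp add: dist_norm field_simps)
    qed
    then show ?thesis using that by (simp add: field_simps)
  qed
  have "infdist (smul c x) N = norm c * infdist x N" for c x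
  proof (cases "c = 0")
    case True
    then show ?thesis using \<open>0 \<in> N\<close> by (simp add: scale_zero_left)
  next
    case False
    then have "infdist x N \<le> inverse (norm c) * infdist (smul c x) N"
      using half[of "inverse c" "smul c x"] by (simp add: norm_inverse)
    then show ?thesis using False half[OF False, of x] by (simp add: field_simps)
  qed
  ultimately show ?thesis using le by (simp add: seminorm_def)
qed

text \<open>With the distance to \<open>N\<close> as seminorm, Hahn-Banach gives a functional that
  vanishes on \<open>N\<close> and whose value at \<open>x\<close> is the distance of
  \<open>x\<close>. By \<open>ann\<close> this distance is zero.\<close>

corollary hahn_banach_annihilator:
  assumes N: "N \<noteq> {}" "\<And>x y. x \<in> N \<Longrightarrow> y \<in> N \<Longrightarrow> x + y \<in> N" "\<And>c x. x \<in> N \<Longrightarrow> smul c x \<in> N"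
    and "closed N"
    and ann: "\<And>\<phi>. \<phi> \<in> dual_space smul \<Longrightarrow> (\<And>n. n \<in> N \<Longrightarrow> \<phi> n = 0) \<Longrightarrow> \<phi> x = 0"
  shows "x \<in> N"
proof -
  obtain \<phi> where \<phi>: "\<phi> \<in> dual_space smul" "\<And>x. norm (\<phi> x) \<le> 4 * infdist x N"
    "\<phi> x = of_real (infdist x N)"
    using hahn_banach_seminorm[OF seminorm_infdist[OF N]] by blast
  have "\<phi> n = 0" if "n \<in> N" for n using \<phi>(2)[of n] that by simp
  then have "infdist x N = 0" using ann[OF \<phi>(1)] \<phi>(3) by simp
  then show ?thesis using in_closed_iff_infdist_zero[OF \<open>closed N\<close> N(1)] by blast
qed

corollary dual_space_separates:
  assumes "\<And>\<phi>. \<phi> \<in> dual_space smul \<Longrightarrow> \<phi> x = \<phi> y"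
  shows "x = y"
proof -
  obtain \<phi> where "\<phi> \<in> dual_space smul" "\<phi> (x - y) = of_real (norm (x - y))"
    using hahn_banach_seminorm[OF seminorm_norm] by blast
  with assms[of \<phi>] show ?thesis by (simp add: dual_space_diff)
qed

end

section \<open>Mean ergodicity on reflexive spaces\<close>

locale bounded_C0_semigroup = banach_space_over smul
  for smul :: "'k::real_or_complex_field \<Rightarrow> 'a::banach \<Rightarrow> 'a" +
  fixes T :: "real \<Rightarrow> 'a \<Rightarrow>\<^sub>L 'a"
  assumes C0: "strongly_continuous_semigroup smul T"
    and bounded: "bounded_semigroup T"
begin

definition M :: real where
  "M = (SOME M. \<forall>t\<ge>0. norm (T t) \<le> M)"

lemma norm_T: "t \<ge> 0 \<Longrightarrow> norm (T t) \<le> M"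
proof -
  have "\<exists>M. \<forall>t\<ge>0. norm (T t) \<le> M"
    using bounded by (auto simp: bounded_semigroup_def bounded_iff)
  then have "\<forall>t\<ge>0. norm (T t) \<le> M" unfolding M_def by (rule someI_ex)
  then show "t \<ge> 0 \<Longrightarrow> norm (T t) \<le> M" by blast
qed

lemma norm_T_apply: "t \<ge> 0 \<Longrightarrow> norm (T t x) \<le> M * norm x"
  by (rule order_trans[OF norm_blinfun]) (simp add: mult_right_mono norm_T)

lemma T_linear: "t \<ge> 0 \<Longrightarrow> Vector_Spaces.linear smul smul (T t)"
  and T_add: "t \<ge> 0 \<Longrightarrow> s \<ge> 0 \<Longrightarrow> T (t + s) x = T t (T s x)"
  and T_cont: "continuous_on {0..} (\<lambda>t. T t x)"
  using C0 by (simp_all add: strongly_continuous_semigroup_def)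

lemma T_integrable: "0 \<le> a \<Longrightarrow> (\<lambda>s. T s x) integrable_on {a..b}"
  by (rule integrable_continuous_real[OF continuous_on_subset[OF T_cont]]) auto

lemma cesaro_add: "cesaro_mean T r (x + y) = cesaro_mean T r x + cesaro_mean T r y"
  by (simp add: cesaro_mean_def blinfun.add_right integral_add T_integrable scaleR_add_right)

lemma cesaro_bounded_linear:
  assumes "bounded_linear h"
  shows "h (cesaro_mean T r x) = (1 / r) *\<^sub>R integral {0..r} (\<lambda>s. h (T s x))"
proof -
  interpret bounded_linear h by fact
  show ?thesis
    using integral_linear[OF T_integrable[of 0 x r] assms] by (simp add: cesaro_mean_def scaleR o_def)
qed

lemma cesaro_commute:
  assumes "t \<ge> 0"
  shows "cesaro_mean T r (T t x) = T t (cesaro_mean T r x)"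
proof -
  have "integral {0..r} (\<lambda>s. T s (T t x)) = integral {0..r} (\<lambda>s. T t (T s x))"
    by (rule integral_cong) (metis T_add add.commute assms atLeastAtMost_iff)
  then show ?thesis
    unfolding cesaro_bounded_linear[OF blinfun.bounded_linear_right] by (simp add: cesaro_mean_def)
qed

lemma cesaro_smul: "cesaro_mean T r (smul c x) = smul c (cesaro_mean T r x)"
proof -
  have "integral {0..r} (\<lambda>s. T s (smul c x)) = integral {0..r} (\<lambda>s. smul c (T s x))"
    by (rule integral_cong) (use T_linear in \<open>simp add: linear_smul_iff\<close>)
  then show ?thesis
    unfolding cesaro_bounded_linear[OF bounded_linear_smul] by (simp add: cesaro_mean_def)
qed

lemma cesaro_diff: "cesaro_mean T r (x - y) = cesaro_mean T r x - cesaro_mean T r y"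
  using cesaro_add[of r "x - y" y] by (simp add: algebra_simps)

lemma norm_cesaro: "r > 0 \<Longrightarrow> norm (cesaro_mean T r x) \<le> M * norm x"
proof -
  assume r: "r > 0"
  have "norm (integral {0..r} (\<lambda>s. T s x)) \<le> M * norm x * (r - 0)"
    using r by (intro integral_bound continuous_on_subset[OF T_cont]) (auto intro: norm_T_apply)
  then show ?thesis using r by (simp add: cesaro_mean_def field_simps)
qed

lemma cesaro_fixed:
  assumes "\<And>t. t \<ge> 0 \<Longrightarrow> T t x = x" "r > 0"
  shows "cesaro_mean T r x = x"
proof -
  have "integral {0..r} (\<lambda>s. T s x) = integral {0..r} (\<lambda>s. x)"
    by (rule integral_cong) (use assms in simp)
  then show ?thesis using assms(2) by (simp add: cesaro_mean_def)
qed

text \<open>The integral of the orbit of \<open>x - T t x\<close> over [0, r] telescopes to the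
  integral of the orbit of \<open>x\<close> over [0, t] minus that over [r, r + t]. Both intervals
  have length \<open>t\<close>, so the integral is bounded in \<open>r\<close>.\<close>

lemma cesaro_coboundary_tendsto_0:
  assumes t: "t \<ge> 0"
  shows "((\<lambda>r. cesaro_mean T r (x - T t x)) \<longlongrightarrow> 0) at_top"
proof (rule Lim_null_comparison)
  let ?I = "\<lambda>a b. integral {a..b} (\<lambda>s. T s x)"
  show "\<forall>\<^sub>F r in at_top. norm (cesaro_mean T r (x - T t x)) \<le> (2 * M * norm x * t) / r"
    using eventually_gt_at_top[of t]
  proof eventually_elim
    case (elim r)
    then have r: "r > 0" using t by simp
    have "integral {0..r} (\<lambda>s. T s (T t x)) = integral {0..r} ((\<lambda>s. T s x) \<circ> (+) t)"
      by (rule integral_cong) (use t in \<open>simp add: add.commute flip: T_add\<close>)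
    also have "\<dots> = ?I t (r + t)"
      unfolding integral_shift_Icc_real by simp
    finally have "integral {0..r} (\<lambda>s. T s (x - T t x)) = ?I 0 r - ?I t (r + t)"
      using integral_diff[OF T_integrable[of 0 x r] T_integrable[of 0 "T t x" r]]
      by (simp add: blinfun.diff_right)
    also have "\<dots> = ?I 0 t - ?I r (r + t)"
    proof -
      have "?I 0 r = ?I 0 t + ?I t r"
        by (rule Henstock_Kurzweil_Integration.integral_combine[symmetric])
          (use elim t in \<open>auto intro: T_integrable\<close>)
      moreover have "?I t (r + t) = ?I t r + ?I r (r + t)"
        by (rule Henstock_Kurzweil_Integration.integral_combine[symmetric])
          (use elim t in \<open>auto intro: T_integrable\<close>)
      ultimately show ?thesis by simp
    qed
    finally have eq: "integral {0..r} (\<lambda>s. T s (x - T t x)) = ?I 0 t - ?I r (r + t)" .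
    have "norm (?I a (a + t)) \<le> M * norm x * (a + t - a)" if "a \<ge> 0" for a
      using t that by (intro integral_bound continuous_on_subset[OF T_cont]) (auto intro: norm_T_apply)
    from this[of 0] this[of r] r
    have "norm (integral {0..r} (\<lambda>s. T s (x - T t x))) \<le> 2 * M * norm x * t"
      unfolding eq using norm_triangle_ineq4[of "?I 0 t" "?I r (r + t)"] by simp
    then show ?case using r by (simp add: cesaro_mean_def divide_right_mono)
  qed
  show "((\<lambda>r. (2 * M * norm x * t) / r) \<longlongrightarrow> 0) at_top"
    by (rule tendsto_divide_0[OF tendsto_const])
      (simp add: filterlim_at_top_imp_at_infinity filterlim_ident)
qed

lemma cesaro_limit_fixed:
  assumes l: "((\<lambda>r. cesaro_mean T r x) \<longlongrightarrow> l) at_top" and t: "t \<ge> 0"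
  shows "T t l = l"
proof -
  have "((\<lambda>r. cesaro_mean T r x - T t (cesaro_mean T r x)) \<longlongrightarrow> l - T t l) at_top"
    by (intro tendsto_intros l blinfun.tendsto)
  moreover have "cesaro_mean T r x - T t (cesaro_mean T r x) = cesaro_mean T r (x - T t x)" for r
    by (simp add: cesaro_diff cesaro_commute[OF t])
  ultimately have "((\<lambda>r. cesaro_mean T r (x - T t x)) \<longlongrightarrow> l - T t l) at_top"
    by simp
  then have "l - T t l = 0"
    using cesaro_coboundary_tendsto_0[OF t, of x] by (rule tendsto_unique[OF trivial_limit_at_top_linorder])
  then show ?thesis by simp
qed

section \<open>Vectors with null Cesaro means, and the limit point in the bidual\<close>

definition null_space :: "'a set" where
  "null_space = {z. ((\<lambda>r. cesaro_mean T r z) \<longlongrightarrow> 0) at_top}"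

lemma null_space_coboundary: "t \<ge> 0 \<Longrightarrow> x - T t x \<in> null_space"
  by (simp add: null_space_def cesaro_coboundary_tendsto_0)

lemma null_space_add: "x \<in> null_space \<Longrightarrow> y \<in> null_space \<Longrightarrow> x + y \<in> null_space"
  unfolding null_space_def by (simp add: cesaro_add) (drule (1) tendsto_add, simp)

lemma null_space_smul: "x \<in> null_space \<Longrightarrow> smul c x \<in> null_space"
  unfolding null_space_def
  by (simp add: cesaro_smul) (drule bounded_linear.tendsto[OF bounded_linear_smul[of c]], simp)

text \<open>By \<open>norm_cesaro\<close> the means are uniformly bounded operators, so null means
  pass to norm limits.\<close>

lemma closed_null_space: "closed null_space"
  unfolding closed_sequential_limits
proof (intro allI impI)
  fix z l assume z: "(\<forall>n. z n \<in> null_space) \<and> z \<longlonglongrightarrow> l"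
  have "\<forall>\<^sub>F r in at_top. norm (cesaro_mean T r l) < e" if e: "e > 0" for e
  proof -
    have "(\<lambda>n. M * norm (l - z n)) \<longlonglongrightarrow> M * norm (l - l)"
      using z by (intro tendsto_intros) auto
    then have "\<forall>\<^sub>F n in sequentially. M * norm (l - z n) < e / 2"
      by (rule order_tendstoD) (use e in simp)
    then obtain n where n: "M * norm (l - z n) < e / 2"
      by (auto simp: eventually_sequentially)
    have "((\<lambda>r. cesaro_mean T r (z n)) \<longlongrightarrow> 0) at_top"
      using z by (simp add: null_space_def)
    then have "\<forall>\<^sub>F r in at_top. norm (cesaro_mean T r (z n)) < e / 2"
      using e by (auto simp: tendsto_iff dest!: spec[of _ "e/2"])
    then show ?thesis using eventually_gt_at_top[of 0]
    proof eventually_elim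
      case (elim r)
      have "norm (cesaro_mean T r l) \<le> norm (cesaro_mean T r (l - z n)) + norm (cesaro_mean T r (z n))"
        using norm_triangle_ineq[of "cesaro_mean T r (l - z n)" "cesaro_mean T r (z n)"]
        by (simp add: cesaro_diff)
      then show ?case
        using norm_cesaro[OF elim(2), of "l - z n"] n elim(1) by linarith
    qed
  qed
  then show "l \<in> null_space"
    by (simp add: null_space_def tendsto_iff)
qed

text \<open>The limit point is taken in the compact product of closed balls indexed by the dual space.\<close>

lemma bidual_cluster_point:
  obtains G :: "('a \<Rightarrow> 'k) \<Rightarrow> 'k" where
    "\<And>P. closed {g. P g} \<Longrightarrow>
       (\<forall>\<^sub>F r in at_top. P (\<lambda>\<phi>. if \<phi> \<in> dual_space smul then \<phi> (cesaro_mean T r x) else 0)) \<Longrightarrow> P G"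
proof -
  \<comment> \<open>The absolute value keeps 0 in every ball, including those indexed by functions
    outside the dual space, where \<open>?c r\<close> takes the value 0.\<close>
  let ?K = "PiE UNIV (\<lambda>\<phi>. cball (0::'k) \<bar>onorm \<phi> * (M * norm x)\<bar>)"
  let ?c = "\<lambda>r \<phi>. if \<phi> \<in> dual_space smul then \<phi> (cesaro_mean T r x) else 0"
  let ?F = "filtermap ?c at_top"
  have "compactin (product_topology (\<lambda>i. euclidean) UNIV) ?K"
    by (simp add: compactin_PiE)
  then have "compact ?K"
    by (simp add: euclidean_product_topology)
  moreover have "?F \<noteq> bot" by (simp add: filtermap_bot_iff)
  moreover have "\<forall>\<^sub>F g in ?F. g \<in> ?K"
    unfolding eventually_filtermap using eventually_gt_at_top[of 0]
  proof eventually_elim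
    case (elim r)
    have "norm (\<phi> (cesaro_mean T r x)) \<le> onorm \<phi> * (M * norm x)" if "\<phi> \<in> dual_space smul" for \<phi>
    proof -
      note bl = dual_space_bounded_linear[OF that]
      show ?thesis
        by (rule order_trans[OF onorm[OF bl]])
          (intro mult_left_mono norm_cesaro elim onorm_pos_le bl)
    qed
    then show ?case by (fastforce simp: PiE_iff)
  qed
  ultimately obtain G where G: "inf (nhds G) ?F \<noteq> bot"
    unfolding compact_filter by blast
  show ?thesis
  proof (rule that, rule ccontr)
    fix P assume P: "closed {g. P g}" "\<forall>\<^sub>F r in at_top. P (?c r)" "\<not> P G"
    have "\<forall>\<^sub>F g in nhds G. \<not> P g"
      using P(1,3) eventually_nhds[of "\<lambda>g. \<not> P g" G] by (auto simp: closed_def Compl_eq)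
    moreover have "\<forall>\<^sub>F g in ?F. P g" using P(2) by (simp add: eventually_filtermap)
    ultimately have "eventually (\<lambda>_. False) (inf (nhds G) ?F)"
      unfolding eventually_inf by blast
    with G show False by (simp add: trivial_limit_def)
  qed
qed

theorem reflexive_imp_mean_ergodic:
  assumes refl: "reflexive_space smul"
  shows "mean_ergodic T"
  unfolding mean_ergodic_def
proof
  fix x
  let ?D = "dual_space smul"
  let ?c = "\<lambda>r \<phi>. if \<phi> \<in> ?D then \<phi> (cesaro_mean T r x) else 0"
  obtain G :: "('a \<Rightarrow> 'k) \<Rightarrow> 'k" where
    G: "\<And>P. closed {g. P g} \<Longrightarrow> (\<forall>\<^sub>F r in at_top. P (?c r)) \<Longrightarrow> P G"
    using bidual_cluster_point[of x] by blast
  have cont: "continuous_on UNIV (\<lambda>g. g \<phi>)" for \<phi> :: "'a \<Rightarrow> 'k"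
    by simp
  \<comment> \<open>Each defining clause of the bidual, with the constant \<open>M * norm x\<close>
    in the last one, is a closed condition satisfied by the means, so \<open>G\<close> inherits
    it.\<close>
  have "G \<in> bidual_space smul"
    unfolding bidual_space_def mem_Collect_eq
  proof (intro conjI ballI allI)
    fix \<phi> \<psi> assume "\<phi> \<in> ?D" "\<psi> \<in> ?D"
    then show "G (\<lambda>x. \<phi> x + \<psi> x) = G \<phi> + G \<psi>"
      by (intro G[where P = "\<lambda>g. g (\<lambda>x. \<phi> x + \<psi> x) = g \<phi> + g \<psi>"])
        (auto simp: dual_space_plus intro!: closed_Collect_eq continuous_intros cont)
  next
    fix c \<phi> assume "\<phi> \<in> ?D"
    then show "G (\<lambda>x. c * \<phi> x) = c * G \<phi>"
      by (intro G[where P = "\<lambda>g. g (\<lambda>x. c * \<phi> x) = c * g \<phi>"])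
        (auto simp: dual_space_times intro!: closed_Collect_eq continuous_intros cont)
  next
    show "\<exists>K. \<forall>\<phi>\<in>?D. norm (G \<phi>) \<le> K * onorm \<phi>"
    proof (intro exI ballI)
      fix \<phi> assume \<phi>: "\<phi> \<in> ?D"
      note bl = dual_space_bounded_linear[OF \<phi>]
      have "norm (?c r \<phi>) \<le> (M * norm x) * onorm \<phi>" if "r > 0" for r
        using order_trans[OF onorm[OF bl] mult_left_mono[OF norm_cesaro[OF that] onorm_pos_le[OF bl]]] \<phi>
        by (simp add: mult.commute)
      then have "\<forall>\<^sub>F r in at_top. norm (?c r \<phi>) \<le> (M * norm x) * onorm \<phi>"
        by (rule eventually_mono[OF eventually_gt_at_top[of 0]])
      then show "norm (G \<phi>) \<le> (M * norm x) * onorm \<phi>"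
        by (intro G[where P = "\<lambda>g. norm (g \<phi>) \<le> (M * norm x) * onorm \<phi>"]
            closed_Collect_le continuous_intros cont)
    qed
  qed
  then obtain l where l: "\<And>\<phi>. \<phi> \<in> ?D \<Longrightarrow> G \<phi> = \<phi> l"
    using refl by (auto simp: reflexive_space_def)
  have fixed: "T t l = l" if t: "t \<ge> 0" for t
  proof (rule dual_space_separates)
    fix \<phi> assume \<phi>: "\<phi> \<in> ?D"
    let ?\<psi> = "\<lambda>x. \<phi> (T t x)"
    have \<psi>: "?\<psi> \<in> ?D"
      by (rule dual_space_compose[OF \<phi> T_linear[OF t] blinfun.bounded_linear_right])
    \<comment> \<open>On the means, this difference is the value of \<phi> at a Cesaro mean of the
      coboundary \<open>x - T t x\<close>, which tends to 0.\<close>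
    have "norm (G \<phi> - G ?\<psi>) \<le> e" if e: "e > 0" for e
    proof -
      have "((\<lambda>r. \<phi> (cesaro_mean T r (x - T t x))) \<longlongrightarrow> \<phi> 0) at_top"
        by (intro bounded_linear.tendsto[OF dual_space_bounded_linear[OF \<phi>]]
            cesaro_coboundary_tendsto_0 t)
      then have "\<forall>\<^sub>F r in at_top. norm (\<phi> (cesaro_mean T r (x - T t x))) < e"
        using e by (simp add: tendsto_iff dual_space_0[OF \<phi>])
      then have "\<forall>\<^sub>F r in at_top. norm (?c r \<phi> - ?c r ?\<psi>) \<le> e"
        by eventually_elim (simp add: \<phi> \<psi> cesaro_diff cesaro_commute[OF t] dual_space_diff[OF \<phi>])
      then show ?thesis
        by (intro G[where P = "\<lambda>g. norm (g \<phi> - g ?\<psi>) \<le> e"] closed_Collect_le continuous_intros cont)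
    qed
    then have "G \<phi> - G ?\<psi> = 0"
      using field_le_epsilon[of "norm (G \<phi> - G ?\<psi>)" 0] by simp
    then show "\<phi> (T t l) = \<phi> l" by (simp add: l \<phi> \<psi>)
  qed
  \<comment> \<open>Coboundaries lie in \<open>null_space\<close>, so a functional annihilating that
    space is constant along the orbit of \<open>x\<close> and on its means. Its values at
    \<open>l\<close> and at \<open>x\<close> therefore agree.\<close>
  have "x - l \<in> null_space"
  proof (rule hahn_banach_annihilator)
    show "null_space \<noteq> {}" using null_space_coboundary[of 0] by blast
    fix \<phi> assume \<phi>: "\<phi> \<in> ?D" and ann: "\<And>n. n \<in> null_space \<Longrightarrow> \<phi> n = 0"
    have inv: "\<phi> (T s x) = \<phi> x" if "s \<ge> 0" for s
      using ann[OF null_space_coboundary[OF that]] by (simp add: dual_space_diff[OF \<phi>])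
    have "\<phi> (cesaro_mean T r x) = \<phi> x" if "r > 0" for r
    proof -
      have "integral {0..r} (\<lambda>s. \<phi> (T s x)) = integral {0..r} (\<lambda>s. \<phi> x)"
        by (rule integral_cong) (simp add: inv)
      then show ?thesis
        using that by (simp add: cesaro_bounded_linear[OF dual_space_bounded_linear[OF \<phi>]])
    qed
    then have "\<forall>\<^sub>F r in at_top. ?c r \<phi> = \<phi> x"
      by (intro eventually_mono[OF eventually_gt_at_top[of 0]]) (simp add: \<phi>)
    then have "G \<phi> = \<phi> x"
      by (intro G[where P = "\<lambda>g. g \<phi> = \<phi> x"] closed_Collect_eq continuous_intros cont)
    then show "\<phi> (x - l) = 0" by (simp add: l \<phi> dual_space_diff)
  qed (auto intro: null_space_add null_space_smul closed_null_space)
  then have "((\<lambda>r. cesaro_mean T r (x - l) + l) \<longlongrightarrow> 0 + l) at_top"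
    unfolding null_space_def by (intro tendsto_intros) simp
  moreover have "\<forall>\<^sub>F r in at_top. cesaro_mean T r (x - l) + l = cesaro_mean T r x"
    using eventually_gt_at_top[of 0]
    by eventually_elim (simp add: cesaro_diff cesaro_fixed fixed)
  ultimately have "((\<lambda>r. cesaro_mean T r x) \<longlongrightarrow> 0 + l) at_top"
    by (rule Lim_transform_eventually)
  then show "\<exists>l. ((\<lambda>r. cesaro_mean T r x) \<longlongrightarrow> l) at_top" by blast
qed

end

section \<open>A semigroup that is not mean ergodic\<close>

text \<open>The rates 2^(-n) decrease to 0. Hence for t >= 0 the values increase in \<open>n\<close>
  to the limit 1, they are multiplicative in \<open>t\<close>, and for fixed \<open>n\<close> they
  tend to 0 as \<open>t\<close> grows.\<close>

definition decay :: "real \<Rightarrow> nat \<Rightarrow> real" where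
  "decay t n = exp (- (t * (1/2) ^ n))"

definition weight :: "real \<Rightarrow> nat \<Rightarrow> real" where
  "weight t n = (case n of 0 \<Rightarrow> decay t 0 | Suc m \<Rightarrow> decay t (Suc m) - decay t m)"

lemma weight_simps [simp]:
  "weight t 0 = decay t 0" "weight t (Suc n) = decay t (Suc n) - decay t n"
  by (simp_all add: weight_def)

lemma sum_weight: "(\<Sum>n\<le>N. weight t n) = decay t N"
  by (induction N) simp_all

lemma decay_add: "decay (t + s) n = decay t n * decay s n"
  by (simp add: decay_def algebra_simps exp_add[symmetric])

lemma decay_le_1: "t \<ge> 0 \<Longrightarrow> decay t n \<le> 1"
  by (simp add: decay_def)

lemma weight_nonneg: "t \<ge> 0 \<Longrightarrow> weight t n \<ge> 0"
  by (cases n) (simp_all add: decay_def mult_left_mono)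

text \<open>From 1 - exp (-y) <= y. The majorant is summable and uniform for \<open>t\<close> in a
  bounded interval, which yields norm convergence and norm continuity of the series
  \<open>T\<close>.\<close>

lemma weight_le:
  assumes "0 \<le> t" "t \<le> R"
  shows "weight t n \<le> 2 * (1 + R) * (1/2) ^ n"
proof (cases n)
  case 0
  then show ?thesis using decay_le_1[of t 0] assms by simp
next
  case (Suc m)
  have "weight t n \<le> 1 - decay t m" using decay_le_1[of t "Suc m"] assms by (simp add: Suc)
  also have "\<dots> \<le> t * (1/2) ^ m" using exp_ge_add_one_self[of "- (t * (1/2)^m)"] by (simp add: decay_def)
  also have "\<dots> \<le> (1 + R) * (1/2) ^ m" using assms by (intro mult_right_mono) auto
  finally have "weight t n \<le> (1 + R) * (1/2) ^ m" .
  then show ?thesis by (simp add: Suc algebra_simps)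
qed

lemma decay_tendsto_1: "decay t \<longlonglongrightarrow> 1"
proof -
  have "(\<lambda>n. exp (- (t * (1/2) ^ n))) \<longlonglongrightarrow> exp (- (t * 0))"
    by (intro tendsto_intros LIMSEQ_realpow_zero) auto
  then show ?thesis by (simp add: decay_def[abs_def])
qed

lemma decay_at_top: "((\<lambda>t. decay t n) \<longlongrightarrow> 0) at_top"
proof -
  have "filterlim (\<lambda>t::real. t * (1/2) ^ n) at_top at_top"
    by (rule filterlim_at_top_mult_tendsto_pos[OF tendsto_const _ filterlim_ident]) simp
  then show ?thesis
    unfolding decay_def by (intro filterlim_compose[OF exp_at_bot]) (simp add: filterlim_uminus_at_top[symmetric])
qed

lemma weight_at_top: "((\<lambda>t. weight t n) \<longlongrightarrow> 0) at_top"
  using decay_at_top[of 0] tendsto_diff[OF decay_at_top decay_at_top] by (cases n) auto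

text \<open>The data produced by both cases of the converse. Bounded vectors \<open>u n\<close> in
  successive blocks with \<open>f (u n) = 1\<close> witness that \<open>f\<close> does not become
  small on the tails; \<open>S_separates\<close> will leave 0 as the only fixed vector.\<close>

locale nonshrinking_projections = banach_space_over smul
  for smul :: "'k::real_or_complex_field \<Rightarrow> 'a::banach \<Rightarrow> 'a" +
  fixes S :: "nat \<Rightarrow> 'a \<Rightarrow>\<^sub>L 'a" and u :: "nat \<Rightarrow> 'a" and f :: "'a \<Rightarrow> 'k" and K :: real
  assumes S_linear: "Vector_Spaces.linear smul smul (S n)"
    and S_bound: "norm (S n) \<le> K"
    and S_S: "S m (S n x) = S (min m n) x"
    and S_0: "S 0 x = 0"
    and S_separates: "(\<And>n. S n x = 0) \<Longrightarrow> x = 0"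
    and u_bound: "norm (u n) \<le> K"
    and S_u_Suc: "S (Suc n) (u n) = u n"
    and S_u: "S n (u n) = 0"
    and f_dual: "f \<in> dual_space smul"
    and f_u: "f (u n) = 1"
begin

lemmas f_add = dual_space_add[OF f_dual]
  and f_diff = dual_space_diff[OF f_dual]
  and f_smul = dual_space_smul[OF f_dual]
  and f_bounded_linear = dual_space_bounded_linear[OF f_dual]

lemma S_smul: "S n (smul c x) = smul c (S n x)"
  using S_linear by (simp add: linear_smul_iff)

text \<open>The part \<open>S n x\<close> is deleted, and the value of \<open>f\<close> lost with it
  is restored by a multiple of \<open>u n\<close>, a vector of the next block.\<close>

definition Q :: "nat \<Rightarrow> 'a \<Rightarrow>\<^sub>L 'a" where
  "Q n = Blinfun (\<lambda>x. x - S n x + smul (f (S n x)) (u n))"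

lemma Q_apply: "Q n x = x - S n x + smul (f (S n x)) (u n)"
proof -
  have "bounded_linear (\<lambda>x. x - S n x + smul (f (S n x)) (u n))"
    by (intro bounded_linear_add bounded_linear_sub bounded_linear_ident blinfun.bounded_linear_right
        bounded_linear_compose[OF bounded_linear_smul_left]
        bounded_linear_compose[OF f_bounded_linear])
  then show ?thesis by (simp add: Q_def bounded_linear_Blinfun_apply)
qed

lemma Q_bound: obtains L where "\<And>n. norm (Q n) \<le> L" "L \<ge> 0"
proof -
  obtain B where B: "B \<ge> 0" "\<And>x. norm (f x) \<le> norm x * B"
    using bounded_linear.nonneg_bounded[OF f_bounded_linear] by blast
  have K: "K \<ge> 0" using S_bound[of 0] norm_ge_zero[of "S 0"] by linarith
  let ?L = "1 + K + K * B * K"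
  have "norm (Q n) \<le> ?L" for n
  proof (rule norm_blinfun_bound)
    show "0 \<le> ?L" using K B by simp
    fix x
    have Sx: "norm (S n x) \<le> K * norm x"
      by (rule order_trans[OF norm_blinfun]) (simp add: S_bound mult_right_mono)
    have "norm (f (S n x)) * norm (u n) \<le> (K * norm x * B) * K"
      using K B(1) u_bound order_trans[OF B(2) mult_right_mono[OF Sx B(1)]]
      by (intro mult_mono) auto
    then have "norm (smul (f (S n x)) (u n)) \<le> (K * B * K) * norm x"
      by (simp add: norm_smul mult_ac)
    then show "norm (Q n x) \<le> ?L * norm x"
      using Sx norm_triangle_ineq4[of x "S n x"]
        norm_triangle_ineq[of "x - S n x" "smul (f (S n x)) (u n)"]
      by (simp add: Q_apply algebra_simps)
  qed
  moreover have "0 \<le> ?L" using K B by simp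
  ultimately show ?thesis by (rule that)
qed

lemma S_u_ge: "m \<le> n \<Longrightarrow> S m (u n) = 0"
  using S_S[of m n "u n"] by (simp add: S_u blinfun.zero_right)

lemma S_u_less: "m < n \<Longrightarrow> S n (u m) = u m"
  using S_S[of n "Suc m" "u m"] by (simp add: S_u_Suc min_absorb2)

lemma S_Q: "m \<le> n \<Longrightarrow> S m (Q n x) = 0"
  by (simp add: Q_apply blinfun.add_right blinfun.diff_right S_S min_absorb1 S_smul S_u_ge)

lemma Q_Q_ge: "m \<le> n \<Longrightarrow> Q m (Q n x) = Q n x"
  using dual_space_0[OF f_dual] by (simp add: Q_apply[of m] S_Q)

text \<open>The difference \<open>Q m x - x\<close> lies in the range of \<open>S n\<close> and in
  the kernel of \<open>f\<close>. So neither the tail of \<open>x\<close> beyond \<open>S n\<close>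
  nor the value \<open>f (S n x)\<close> changes, and these two determine
  \<open>Q n x\<close>.\<close>

lemma Q_Q_less:
  assumes "m < n"
  shows "Q n (Q m x) = Q n x"
proof -
  have S: "S n (Q m x) = S n x - S m x + smul (f (S m x)) (u m)"
    using assms by (simp add: Q_apply blinfun.add_right blinfun.diff_right S_S min_absorb2 S_smul S_u_less)
  then have "f (S n (Q m x)) = f (S n x)"
    by (simp add: f_add f_diff f_smul f_u)
  then show ?thesis
    unfolding Q_apply[of n "Q m x"] S by (simp add: Q_apply)
qed

lemma f_Q: "f (Q n x) = f x"
  by (simp add: Q_apply f_add f_diff f_smul f_u)

lemma Q_0: "Q 0 x = x"
  using dual_space_0[OF f_dual] by (simp add: Q_apply S_0)

section \<open>The semigroup as an infinite convex combination of the operators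
  \<open>Q n\<close>\<close>

definition T_part :: "nat \<Rightarrow> real \<Rightarrow> 'a \<Rightarrow>\<^sub>L 'a" where
  "T_part N t = (\<Sum>n\<le>N. weight t n *\<^sub>R Q n)"

text \<open>The weights are the increments of the distribution function \<^term>\<open>decay t\<close>. As the product of two
  \<^term>\<open>Q\<close>s is the one with the larger index, composition multiplies distribution functions.\<close>

definition T :: "real \<Rightarrow> 'a \<Rightarrow>\<^sub>L 'a" where
  "T t = (\<Sum>n. weight t n *\<^sub>R Q n)"

lemma T_part_apply: "T_part N t x = (\<Sum>n\<le>N. weight t n *\<^sub>R Q n x)"
  by (simp add: T_part_def blinfun.sum_left blinfun.scaleR_left)

lemma T_part_Q:
  assumes "N < n"
  shows "T_part N t (Q n x) = decay t N *\<^sub>R Q n x"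
proof -
  have "T_part N t (Q n x) = (\<Sum>k\<le>N. weight t k *\<^sub>R Q n x)"
    unfolding T_part_apply by (rule sum.cong) (use assms in \<open>simp_all add: Q_Q_ge\<close>)
  then show ?thesis by (simp add: scaleR_left.sum[symmetric] sum_weight)
qed

lemma Q_T_part:
  assumes "N < n"
  shows "Q n (T_part N t x) = decay t N *\<^sub>R Q n x"
proof -
  have "Q n (T_part N t x) = (\<Sum>k\<le>N. weight t k *\<^sub>R Q n x)"
    unfolding T_part_apply blinfun.sum_right
    by (rule sum.cong) (use assms in \<open>simp_all add: blinfun.scaleR_right Q_Q_less\<close>)
  then show ?thesis by (simp add: scaleR_left.sum[symmetric] sum_weight)
qed

lemma T_part_Suc: "T_part (Suc N) t x = T_part N t x + weight t (Suc N) *\<^sub>R Q (Suc N) x"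
  by (simp add: T_part_apply)

text \<open>The truncations already multiply exactly. In the inductive step all new products
  collapse to \<open>Q (Suc N)\<close>, and their total coefficient is the increment of
  \<open>decay t n * decay s n\<close> from \<open>N\<close> to \<open>Suc N\<close>.\<close>

lemma T_part_add: "T_part N t (T_part N s x) = T_part N (t + s) x"
proof (induction N)
  case 0
  show ?case by (simp add: T_part_apply Q_0 decay_add)
next
  case (Suc N)
  let ?q = "Q (Suc N) x"
  have "T_part (Suc N) t (T_part (Suc N) s x) = T_part N (t + s) x +
     (weight s (Suc N) * decay t N + weight t (Suc N) * decay s N + weight t (Suc N) * weight s (Suc N)) *\<^sub>R ?q"
    by (simp only: T_part_Suc blinfun.add_right blinfun.scaleR_right Suc T_part_Q Q_T_part Q_Q_ge
        lessI order_refl) (simp only: algebra_simps scaleR_scaleR)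
  also have "weight s (Suc N) * decay t N + weight t (Suc N) * decay s N + weight t (Suc N) * weight s (Suc N)
     = weight (t + s) (Suc N)"
    by (simp add: decay_add algebra_simps)
  finally show ?case by (simp only: T_part_Suc)
qed

lemma T_part_uniform_limit:
  assumes "R \<ge> 0"
  shows "uniform_limit {0..R} T_part T sequentially"
proof -
  obtain L where L: "\<And>n. norm (Q n) \<le> L" "L \<ge> 0" using Q_bound by blast
  have bound: "norm (weight t n *\<^sub>R Q n) \<le> 2 * (1 + R) * (1/2) ^ n * L" if "t \<in> {0..R}" for t n
    using that weight_le[of t R n] weight_nonneg[of t n] L assms
    by (auto intro!: mult_mono)
  have "summable (\<lambda>n. 2 * (1 + R) * (1/2) ^ n * L)"
    by (intro summable_mult summable_mult2 summable_geometric) simp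
  then have "uniform_limit {0..R} (\<lambda>N t. \<Sum>n<N. weight t n *\<^sub>R Q n) T sequentially"
    unfolding T_def[abs_def] by (intro Weierstrass_m_test) (use bound in auto)
  then have "uniform_limit {0..R} (\<lambda>N t. \<Sum>n<Suc N. weight t n *\<^sub>R Q n) T sequentially"
    by (rule filterlim_compose[OF _ filterlim_Suc])
  then show ?thesis by (simp only: T_part_def[abs_def] lessThan_Suc_atMost)
qed

lemma T_part_tendsto: "t \<ge> 0 \<Longrightarrow> (\<lambda>N. T_part N t) \<longlonglongrightarrow> T t"
  using tendsto_uniform_limitI[OF T_part_uniform_limit[of t], of t] by simp

lemma T_part_apply_tendsto: "t \<ge> 0 \<Longrightarrow> (\<lambda>N. T_part N t x) \<longlonglongrightarrow> T t x"
  by (intro blinfun.tendsto T_part_tendsto tendsto_const)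

lemma T_continuous: "continuous_on {0..} T"
proof -
  have cont: "continuous_on {0..R} T" if "R \<ge> 0" for R
  proof (rule uniform_limit_theorem[OF _ T_part_uniform_limit[OF that]])
    have "continuous_on {0..R} (\<lambda>t. weight t n)" for n
      by (cases n) (auto simp: decay_def intro!: continuous_intros)
    then show "\<forall>\<^sub>F N in sequentially. continuous_on {0..R} (T_part N)"
      unfolding T_part_def[abs_def] by (intro always_eventually allI continuous_intros)
  qed simp
  show ?thesis
    unfolding continuous_on_def
  proof
    fix t :: real assume t: "t \<in> {0..}"
    have "at t within {0..} = at t within {0..t+1}"
      by (rule at_within_nhd[of t "{..<t+1}"]) (use t in auto)
    then show "(T \<longlongrightarrow> T t) (at t within {0..})"
      using cont[of "t + 1"] t by (simp add: continuous_on_def)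
  qed
qed

text \<open>The weights are nonnegative and their partial sums \<open>decay t N\<close> are at most
  1, so a common bound for the \<open>Q n\<close> bounds the semigroup.\<close>

lemma T_bounded: "bounded_semigroup T"
proof -
  obtain L where L: "\<And>n. norm (Q n) \<le> L" "L \<ge> 0" using Q_bound by blast
  have "norm (T t) \<le> L" if t: "t \<ge> 0" for t
  proof (rule LIMSEQ_le_const2[OF tendsto_norm[OF T_part_tendsto[OF t]]], intro exI allI impI)
    fix N
    have "norm (T_part N t) \<le> (\<Sum>n\<le>N. norm (weight t n *\<^sub>R Q n))"
      unfolding T_part_def by (rule norm_sum)
    also have "\<dots> \<le> (\<Sum>n\<le>N. weight t n * L)"
      using L weight_nonneg[OF t] by (intro sum_mono) (simp add: mult_left_mono)
    also have "\<dots> = decay t N * L" by (simp add: sum_distrib_right[symmetric] sum_weight)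
    also have "\<dots> \<le> L" using decay_le_1[OF t] L(2) by (simp add: mult_left_le_one_le decay_def)
    finally show "norm (T_part N t) \<le> L" .
  qed
  then show ?thesis by (auto simp: bounded_semigroup_def bounded_iff)
qed

lemma T_semigroup: "uniformly_continuous_semigroup smul T"
proof -
  have Q_smul: "Q n (smul c x) = smul c (Q n x)" for n c x
    by (simp add: Q_apply S_smul f_smul scale_right_distrib scale_right_diff_distrib)
  have "T t (smul c x) = smul c (T t x)" if t: "t \<ge> 0" for t c x
  proof (rule LIMSEQ_unique[OF T_part_apply_tendsto[OF t]])
    have "smul c (T_part N t x) = T_part N t (smul c x)" for N
      unfolding T_part_apply
      by (simp add: Q_smul smul_scaleR linear_sum[OF bounded_linear.linear[OF bounded_linear_smul]])
    then show "(\<lambda>N. T_part N t (smul c x)) \<longlonglongrightarrow> smul c (T t x)"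
      using bounded_linear.tendsto[OF bounded_linear_smul T_part_apply_tendsto[OF t, of x], of c] by simp
  qed
  moreover have "T 0 = id_blinfun"
  proof (rule LIMSEQ_unique[OF T_part_tendsto[of 0]])
    \<comment> \<open>At time 0 every \<open>decay\<close> is 1, so only the weight of
      \<open>Q 0\<close> survives, and \<open>Q 0\<close> is the identity by
      \<open>S_0\<close>.\<close>
    have "T_part N 0 = id_blinfun" for N
    proof (rule blinfun_eqI)
      have "T_part N 0 x = Q 0 x" for x
        by (induction N) (simp_all add: T_part_apply decay_def)
      then show "T_part N 0 x = id_blinfun x" for x by (simp add: Q_0)
    qed
    then show "(\<lambda>N. T_part N 0) \<longlonglongrightarrow> id_blinfun" by simp
  qed simp
  moreover have "T (t + s) = T t o\<^sub>L T s" if t: "t \<ge> 0" and s: "s \<ge> 0" for t s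
  proof (rule blinfun_eqI, rule LIMSEQ_unique[OF T_part_apply_tendsto])
    fix x
    have "(\<lambda>N. T_part N t (T_part N s x)) \<longlonglongrightarrow> T t (T s x)"
      by (intro blinfun.tendsto T_part_tendsto T_part_apply_tendsto t s)
    then show "(\<lambda>N. T_part N (t + s) x) \<longlonglongrightarrow> (T t o\<^sub>L T s) x" by (simp add: T_part_add)
  qed (use t s in simp)
  moreover have "continuous_on {0..} (\<lambda>t. T t x)" for x
    by (intro continuous_intros T_continuous)
  ultimately show ?thesis
    using T_continuous
    by (simp add: uniformly_continuous_semigroup_def strongly_continuous_semigroup_def
        linear_smul_iff blinfun.add_right)
qed

sublocale bounded_C0_semigroup smul T
  using T_semigroup T_bounded by unfold_locales (simp_all add: uniformly_continuous_semigroup_def)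

lemma f_T: "t \<ge> 0 \<Longrightarrow> f (T t x) = f x"
proof -
  assume t: "t \<ge> 0"
  have "f (T_part N t x) = decay t N *\<^sub>R f x" for N
    unfolding T_part_apply
    by (simp add: linear_sum[OF bounded_linear.linear[OF f_bounded_linear]]
        linear_scale[OF bounded_linear.linear[OF f_bounded_linear]] f_Q
        scaleR_left.sum[symmetric] sum_weight)
  moreover have "(\<lambda>N. f (T_part N t x)) \<longlonglongrightarrow> f (T t x)"
    by (rule bounded_linear.tendsto[OF f_bounded_linear T_part_apply_tendsto[OF t]])
  moreover have "(\<lambda>N. decay t N *\<^sub>R f x) \<longlonglongrightarrow> 1 *\<^sub>R f x"
    by (intro tendsto_intros decay_tendsto_1)
  ultimately show ?thesis using LIMSEQ_unique by force
qed

text \<open>Terms with index at least \<open>m\<close> are annihilated by \<open>S m\<close>. Only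
  finitely many remain, so the behaviour for large \<open>t\<close> can be read off from the single
  weights.\<close>

lemma S_T:
  assumes t: "t \<ge> 0"
  shows "S m (T t x) = (\<Sum>n<m. weight t n *\<^sub>R S m (Q n x))"
proof (rule LIMSEQ_unique)
  show "(\<lambda>N. S m (T_part N t x)) \<longlonglongrightarrow> S m (T t x)"
    by (intro blinfun.tendsto tendsto_const T_part_apply_tendsto t)
  have "S m (T_part N t x) = (\<Sum>n<m. weight t n *\<^sub>R S m (Q n x))" if "N \<ge> m" for N
    unfolding T_part_apply blinfun.sum_right blinfun.scaleR_right
    by (rule sum.mono_neutral_right) (use that in \<open>auto simp: S_Q\<close>)
  then show "(\<lambda>N. S m (T_part N t x)) \<longlonglongrightarrow> (\<Sum>n<m. weight t n *\<^sub>R S m (Q n x))"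
    by (intro tendsto_eventually eventually_sequentiallyI)
qed

theorem not_mean_ergodic: "\<not> mean_ergodic T"
proof
  assume "mean_ergodic T"
  then obtain l where l: "((\<lambda>r. cesaro_mean T r (u 0)) \<longlongrightarrow> l) at_top"
    by (auto simp: mean_ergodic_def)
  \<comment> \<open>Since \<open>l\<close> is fixed, \<open>S m l = S m (T t l)\<close> is a finite
    sum whose weights tend to 0 as \<open>t\<close> grows.\<close>
  have "S m l = 0" for m
  proof -
    have "((\<lambda>t. \<Sum>n<m. weight t n *\<^sub>R S m (Q n l)) \<longlongrightarrow> (\<Sum>n<m. 0 *\<^sub>R S m (Q n l))) at_top"
      by (intro tendsto_intros weight_at_top)
    moreover have "\<forall>\<^sub>F t in at_top. (\<Sum>n<m. weight t n *\<^sub>R S m (Q n l)) = S m l"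
      using eventually_ge_at_top[of 0]
      by eventually_elim (simp add: S_T[symmetric] cesaro_limit_fixed[OF l])
    ultimately have "((\<lambda>t::real. S m l) \<longlongrightarrow> 0) at_top"
      by (auto intro: Lim_transform_eventually)
    then show ?thesis by (simp add: tendsto_const_iff)
  qed
  then have "l = 0" by (rule S_separates)
  have "f (cesaro_mean T r (u 0)) = 1" if "r > 0" for r
  proof -
    have "integral {0..r} (\<lambda>s. f (T s (u 0))) = integral {0..r} (\<lambda>s. 1)"
      by (rule integral_cong) (simp add: f_T f_u)
    then show ?thesis using that by (simp add: cesaro_bounded_linear[OF f_bounded_linear])
  qed
  then have "\<forall>\<^sub>F r in at_top. f (cesaro_mean T r (u 0)) = 1"
    by (rule eventually_mono[OF eventually_gt_at_top[of 0]])
  then have "((\<lambda>r. f (cesaro_mean T r (u 0))) \<longlongrightarrow> 1) at_top"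
    by (rule tendsto_eventually)
  moreover have "((\<lambda>r. f (cesaro_mean T r (u 0))) \<longlongrightarrow> f l) at_top"
    by (rule bounded_linear.tendsto[OF f_bounded_linear l])
  ultimately have "f l = 1"
    using tendsto_unique[OF trivial_limit_at_top_linorder] by blast
  then show False using \<open>l = 0\<close> dual_space_0[OF f_dual] by simp
qed

end

section \<open>Finite-dimensional spaces are reflexive\<close>

text \<open>Induction on \<open>B\<close>: subtracting a multiple of the evaluation at
  \<open>b\<close> leaves a functional that vanishes on the common kernel of the remaining
  evaluations. The factor is \<open>F \<psi> / \<psi> b\<close> for any \<psi> in that kernel with
  nonzero \<open>F \<psi>\<close>, and 0 if there is none.\<close>

lemma functional_eq_sum_evaluations:
  fixes F :: "('a \<Rightarrow> 'k::field) \<Rightarrow> 'k"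
  assumes "finite B"
    and D_diff: "\<And>\<phi> \<psi>. \<phi> \<in> D \<Longrightarrow> \<psi> \<in> D \<Longrightarrow> (\<lambda>x. \<phi> x - \<psi> x) \<in> D"
    and D_scale: "\<And>c \<phi>. \<phi> \<in> D \<Longrightarrow> (\<lambda>x. c * \<phi> x) \<in> D"
    and "\<And>\<phi> \<psi>. \<phi> \<in> D \<Longrightarrow> \<psi> \<in> D \<Longrightarrow> F (\<lambda>x. \<phi> x - \<psi> x) = F \<phi> - F \<psi>"
    and "\<And>c \<phi>. \<phi> \<in> D \<Longrightarrow> F (\<lambda>x. c * \<phi> x) = c * F \<phi>"
    and "\<And>\<phi>. \<phi> \<in> D \<Longrightarrow> (\<And>b. b \<in> B \<Longrightarrow> \<phi> b = 0) \<Longrightarrow> F \<phi> = 0"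
  shows "\<exists>c. \<forall>\<phi>\<in>D. F \<phi> = (\<Sum>b\<in>B. c b * \<phi> b)"
  using assms(1,4-)
proof (induction B arbitrary: F rule: finite_induct)
  case empty
  then show ?case by simp
next
  case (insert b B)
  note F_diff = insert.prems(1) and F_scale = insert.prems(2) and F_zero = insert.prems(3)
  have "\<exists>d. \<forall>\<phi>\<in>D. (\<forall>b\<in>B. \<phi> b = 0) \<longrightarrow> F \<phi> - d * \<phi> b = 0"
  proof (cases "\<forall>\<phi>\<in>D. (\<forall>b\<in>B. \<phi> b = 0) \<longrightarrow> F \<phi> = 0")
    case True
    then show ?thesis by (intro exI[of _ 0]) simp
  next
    case False
    then obtain \<psi> where \<psi>: "\<psi> \<in> D" "\<And>b. b \<in> B \<Longrightarrow> \<psi> b = 0" "F \<psi> \<noteq> 0" by blast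
    then have b: "\<psi> b \<noteq> 0" using F_zero[of \<psi>] by auto
    have "F \<phi> - (F \<psi> / \<psi> b) * \<phi> b = 0" if \<phi>: "\<phi> \<in> D" "\<forall>b\<in>B. \<phi> b = 0" for \<phi>
    proof -
      let ?c = "\<phi> b / \<psi> b"
      note c = D_scale[OF \<psi>(1), of ?c]
      have "F (\<lambda>x. \<phi> x - ?c * \<psi> x) = 0"
        by (rule F_zero[OF D_diff[OF \<phi>(1) c]]) (use \<phi>(2) \<psi>(2) b in auto)
      then show ?thesis
        unfolding F_diff[OF \<phi>(1) c] F_scale[OF \<psi>(1)] by (simp add: mult.commute)
    qed
    then show ?thesis by blast
  qed
  then obtain d where d: "\<And>\<phi>. \<phi> \<in> D \<Longrightarrow> (\<And>b. b \<in> B \<Longrightarrow> \<phi> b = 0) \<Longrightarrow> F \<phi> - d * \<phi> b = 0"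
    by blast
  have "\<exists>c. \<forall>\<phi>\<in>D. F \<phi> - d * \<phi> b = (\<Sum>b\<in>B. c b * \<phi> b)"
    by (rule insert.IH) (use F_diff F_scale d in \<open>simp_all add: algebra_simps\<close>)
  then obtain c where c: "\<And>\<phi>. \<phi> \<in> D \<Longrightarrow> F \<phi> - d * \<phi> b = (\<Sum>b\<in>B. c b * \<phi> b)" by blast
  have "(\<Sum>k\<in>B. (c(b := d)) k * \<phi> k) = (\<Sum>k\<in>B. c k * \<phi> k)" for \<phi> :: "'a \<Rightarrow> 'k"
    by (rule sum.cong) (use insert.hyps in auto)
  then have "F \<phi> = (\<Sum>k\<in>insert b B. (c(b := d)) k * \<phi> k)" if "\<phi> \<in> D" for \<phi>
    using c[OF that] insert.hyps by (simp add: algebra_simps)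
  then show ?case by blast
qed

context banach_space_over
begin

lemma bidual_space_add:
  "F \<in> bidual_space smul \<Longrightarrow> \<phi> \<in> dual_space smul \<Longrightarrow> \<psi> \<in> dual_space smul \<Longrightarrow>
    F (\<lambda>x. \<phi> x + \<psi> x) = F \<phi> + F \<psi>"
  and bidual_space_times:
  "F \<in> bidual_space smul \<Longrightarrow> \<phi> \<in> dual_space smul \<Longrightarrow> F (\<lambda>x. c * \<phi> x) = c * F \<phi>"
  by (simp_all add: bidual_space_def)

lemma bidual_space_diff:
  assumes "F \<in> bidual_space smul" "\<phi> \<in> dual_space smul" "\<psi> \<in> dual_space smul"
  shows "F (\<lambda>x. \<phi> x - \<psi> x) = F \<phi> - F \<psi>"
  using bidual_space_add[OF assms(1,2) dual_space_times[OF assms(3), of "-1"]]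
    bidual_space_times[OF assms(1,3), of "-1"] by simp

text \<open>A functional that vanishes on the spanning set \<open>B\<close> is zero, so a bidual
  functional is a combination of evaluations at points of \<open>B\<close>; the same combination of
  these points represents it.\<close>

lemma finite_dimensional_imp_reflexive:
  assumes "finite_dimensional_vector_space smul B"
  shows "reflexive_space smul"
  unfolding reflexive_space_def
proof
  interpret fd: finite_dimensional_vector_space smul B by fact
  fix F assume F: "F \<in> bidual_space smul"
  let ?D = "dual_space smul"
  have lin: "Vector_Spaces.linear smul (*) \<phi>" if "\<phi> \<in> ?D" for \<phi>
    using that by (simp add: dual_space_def)
  note scale = bidual_space_times[OF F]
  have "\<exists>c. \<forall>\<phi>\<in>?D. F \<phi> = (\<Sum>b\<in>B. c b * \<phi> b)"
  proof (rule functional_eq_sum_evaluations)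
    fix \<phi> assume \<phi>: "\<phi> \<in> ?D" "\<And>b. b \<in> B \<Longrightarrow> \<phi> b = 0"
    interpret vs: vector_space_pair smul "(*) :: 'k \<Rightarrow> 'k \<Rightarrow> 'k"
      using vector_space_axioms vector_space_field by (simp add: vector_space_pair_def)
    have "\<phi> x = 0" for x
      by (rule vs.linear_eq_0_on_span[OF lin[OF \<phi>(1)], of B]) (use \<phi>(2) fd.span_Basis in auto)
    then have "\<phi> = (\<lambda>x. 0 * \<phi> x)" by auto
    then show "F \<phi> = 0" using scale[OF \<phi>(1), of 0] by simp
  qed (use fd.finite_Basis bidual_space_diff[OF F] scale in \<open>auto intro: dual_space_minus dual_space_times\<close>)
  then obtain c where c: "\<And>\<phi>. \<phi> \<in> ?D \<Longrightarrow> F \<phi> = (\<Sum>b\<in>B. c b * \<phi> b)" by blast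
  have "F \<phi> = \<phi> (\<Sum>b\<in>B. smul (c b) b)" if "\<phi> \<in> ?D" for \<phi>
    unfolding c[OF that] linear_sum[OF bounded_linear.linear[OF dual_space_bounded_linear[OF that]]]
    by (simp add: dual_space_smul[OF that])
  then show "\<exists>x. \<forall>\<phi>\<in>?D. F \<phi> = \<phi> x" by blast
qed

end


section \<open>Schauder bases\<close>

text \<open>Zabreiko's lemma; it replaces the open mapping theorem in the proof that the partial sum
  projections of a basis are uniformly bounded.\<close>

theorem countably_subadditive_seminorm_bounded:
  fixes q :: "'a::banach \<Rightarrow> real"
  assumes add: "\<And>x y. q (x + y) \<le> q x + q y"
    and scale: "\<And>c x. q (c *\<^sub>R x) \<le> \<bar>c\<bar> * q x"
    and nonneg: "\<And>x. 0 \<le> q x"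
    and suminf: "\<And>x s. x sums s \<Longrightarrow> summable (\<lambda>n. q (x n)) \<Longrightarrow> q s \<le> (\<Sum>n. q (x n))"
  obtains C where "\<And>x. q x \<le> C * norm x" "C \<ge> 0"
proof -
  \<comment> \<open>These sets cover the space, so by Baire's theorem the closure of one of them
    contains a ball.\<close>
  define A where "A k = {x. q x \<le> real k}" for k :: nat
  have "\<exists>k. interior (closure (A k)) \<noteq> {}"
  proof (rule ccontr)
    assume "\<not> ?thesis"
    then have "euclidean interior_of \<Union>(range (\<lambda>k. closure (A k))) = {}"
      by (intro Baire_category_alt) (auto simp: completely_metrizable_space_euclidean)
    moreover have "(\<Union>k. closure (A k)) = UNIV"
    proof -
      have "x \<in> closure (A (nat \<lceil>q x\<rceil>))" for x
        by (rule subsetD[OF closure_subset]) (simp add: A_def real_nat_ceiling_ge)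
      then show ?thesis by blast
    qed
    ultimately show False by simp
  qed
  then obtain k x0 where "x0 \<in> interior (closure (A k))" by blast
  then obtain r where r: "r > 0" "ball x0 r \<subseteq> closure (A k)"
    by (auto simp: mem_interior)
  \<comment> \<open>Half the difference of approximants to \<open>x0 + y\<close> and
    \<open>x0 - y\<close> approximates \<open>y\<close>, which moves the ball to the origin without
    enlarging the bound \<open>k\<close>.\<close>
  have near: "\<exists>z. q z \<le> real k \<and> norm (y - z) < \<epsilon>" if y: "norm y < r" and \<epsilon>: "\<epsilon> > 0" for y \<epsilon>
  proof -
    have "x0 + y \<in> closure (A k)" "x0 - y \<in> closure (A k)"
      using r(2) y by (auto simp: dist_norm subset_iff)
    then obtain a b where a: "q a \<le> k" "dist a (x0 + y) < \<epsilon>" and b: "q b \<le> k" "dist b (x0 - y) < \<epsilon>"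
      using \<epsilon> unfolding closure_approachable A_def by blast
    let ?z = "(1/2) *\<^sub>R (a + (-1) *\<^sub>R b)"
    have "q ?z \<le> (1/2) * (q a + q b)"
      using scale[of "1/2" "a + (-1) *\<^sub>R b"] add[of a "(-1) *\<^sub>R b"] scale[of "-1" b] by simp
    then have "q ?z \<le> k" using a b by simp
    moreover have "norm (y - ?z) < \<epsilon>"
    proof -
      have "2 *\<^sub>R (y - ?z) = (b - (x0 - y)) - (a - (x0 + y))"
        by (simp add: algebra_simps scaleR_2)
      then have "2 * norm (y - ?z) \<le> norm (b - (x0 - y)) + norm (a - (x0 + y))"
        using norm_triangle_ineq4[of "b - (x0 - y)" "a - (x0 + y)"]
        by (metis abs_numeral norm_scaleR)
      then show ?thesis using a b by (simp add: dist_norm)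
    qed
    ultimately show ?thesis by blast
  qed
  define c where "c = 2 * real k / r"
  have c: "c \<ge> 0" using r by (simp add: c_def)
  have "\<exists>z. q z \<le> c * norm y \<and> norm (y - z) \<le> norm y / 2" for y
  proof (cases "y = 0")
    case True
    have "q 0 \<le> 0" using scale[of 0 0] by simp
    then show ?thesis using True by (intro exI[of _ 0]) simp
  next
    case False
    \<comment> \<open>Scaling moves \<open>y\<close> to norm \<open>r / 2\<close>, inside the ball;
      undoing it turns the bound \<open>k\<close> into \<open>c * norm y\<close>.\<close>
    define s where "s = r / (2 * norm y)"
    have s: "s > 0" "s * norm y < r" using False r by (auto simp: s_def field_simps)
    then obtain z where z: "q z \<le> k" "norm (s *\<^sub>R y - z) < s * (norm y / 2)"
      using near[of "s *\<^sub>R y" "s * (norm y / 2)"] False by auto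
    have "q (inverse s *\<^sub>R z) \<le> inverse s * k"
      by (rule order_trans[OF scale]) (use z(1) s(1) in \<open>simp add: mult_left_mono\<close>)
    also have "inverse s * k = c * norm y" by (simp add: s_def c_def)
    finally have "q (inverse s *\<^sub>R z) \<le> c * norm y" .
    moreover have "norm (y - inverse s *\<^sub>R z) \<le> norm y / 2"
    proof -
      have "s *\<^sub>R y - z = s *\<^sub>R (y - inverse s *\<^sub>R z)" using s(1) by (simp add: algebra_simps)
      then have "s * norm (y - inverse s *\<^sub>R z) < s * (norm y / 2)" using z(2) s(1) by simp
      then show ?thesis using s(1) by simp
    qed
    ultimately show ?thesis by blast
  qed
  then obtain z where z: "\<And>y. q (z y) \<le> c * norm y" "\<And>y. norm (y - z y) \<le> norm y / 2" by metis
  have "q x \<le> (2 * c) * norm x" for x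
  proof -
    \<comment> \<open>These are the remainders of successive approximation. They halve in norm, so
      \<open>x\<close> is the sum of the approximants \<open>z (y n)\<close>, whose
      \<open>q\<close>-values are dominated by a geometric series.\<close>
    define y where "y n = ((\<lambda>y. y - z y) ^^ n) x" for n
    have y_Suc: "y (Suc n) = y n - z (y n)" for n by (simp add: y_def)
    have y_norm: "norm (y n) \<le> norm x * (1/2) ^ n" for n
    proof (induction n)
      case 0
      show ?case by (simp add: y_def)
    next
      case (Suc n)
      then show ?case using z(2)[of "y n"] by (simp add: y_Suc)
    qed
    have "(\<lambda>n. norm x * (1/2) ^ n) \<longlonglongrightarrow> norm x * 0"
      by (intro tendsto_intros LIMSEQ_realpow_zero) auto
    then have "(\<lambda>n. norm x * (1/2) ^ n) \<longlonglongrightarrow> 0" by simp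
    then have "y \<longlonglongrightarrow> 0"
      by (rule Lim_null_comparison[OF always_eventually[OF allI[OF y_norm]]])
    then have "(\<lambda>n. x - y n) \<longlonglongrightarrow> x - 0" by (intro tendsto_intros)
    moreover have "(\<Sum>k<n. z (y k)) = x - y n" for n
    proof (induction n)
      case 0
      show ?case by (simp add: y_def)
    next
      case (Suc n)
      then show ?case by (simp add: y_Suc)
    qed
    ultimately have sums: "(\<lambda>n. z (y n)) sums x" by (simp add: sums_def)
    have le: "q (z (y n)) \<le> (c * norm x) * (1/2) ^ n" for n
      using order_trans[OF z(1) mult_left_mono[OF y_norm c]] by (simp add: mult.assoc)
    have geo: "(\<lambda>n. (c * norm x) * (1/2::real) ^ n) sums ((c * norm x) * 2)"
      using geometric_sums[of "1/2::real"] by (intro sums_mult) simp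
    have summ: "summable (\<lambda>n. q (z (y n)))"
      by (rule summable_comparison_test'[OF sums_summable[OF geo], of 0]) (use le nonneg in simp)
    have "q x \<le> (\<Sum>n. q (z (y n)))" by (rule suminf[OF sums summ])
    also have "\<dots> \<le> (c * norm x) * 2"
      using suminf_le[OF le summ sums_summable[OF geo]] sums_unique[OF geo] by simp
    finally show ?thesis by (simp add: mult_ac)
  qed
  then show ?thesis using that[of "2 * c"] c by simp
qed

text \<open>If all later terms stayed within d/2 of \<open>v N\<close>, any two of them would be
  closer than d. A jump beyond every index permits choosing a subsequence with increments bounded
  below.\<close>

lemma not_Cauchy_jump:
  fixes v :: "nat \<Rightarrow> 'b::metric_space"
  assumes "\<not> Cauchy v"
  obtains \<delta> where "\<delta> > 0" "\<And>N. \<exists>m>N. \<delta> \<le> dist (v m) (v N)"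
proof -
  obtain d where d: "d > 0" "\<And>N. \<exists>m\<ge>N. \<exists>n\<ge>N. d \<le> dist (v m) (v n)"
    using assms unfolding Cauchy_def not_le[symmetric] by (meson not_less)
  have "\<exists>m>N. d / 2 \<le> dist (v m) (v N)" for N
  proof (rule ccontr)
    assume "\<not> ?thesis"
    then have "dist (v m) (v N) < d / 2" if "m \<ge> N" for m
      using that d(1) by (cases "m = N") (auto simp: not_le)
    then show False using d(2)[of N] by (metis dist_triangle_half_l not_le)
  qed
  then show ?thesis using that[of "d / 2"] d(1) by simp
qed

locale schauder_basis_space = banach_space_over smul
  for smul :: "'k::real_or_complex_field \<Rightarrow> 'a::banach \<Rightarrow> 'a" +
  fixes e :: "nat \<Rightarrow> 'a"
  assumes basis: "schauder_basis smul e"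
begin

section \<open>Coefficient functionals and partial sum projections\<close>

definition coeff :: "'a \<Rightarrow> nat \<Rightarrow> 'k" where
  "coeff x = (THE a. (\<lambda>n. smul (a n) (e n)) sums x)"

lemma coeff_sums: "(\<lambda>n. smul (coeff x n) (e n)) sums x"
  unfolding coeff_def using basis
  by (intro theI'[where P = "\<lambda>a. (\<lambda>n. smul (a n) (e n)) sums x"]) (simp add: schauder_basis_def)

lemma coeff_unique: "(\<lambda>n. smul (a n) (e n)) sums x \<Longrightarrow> coeff x = a"
  unfolding coeff_def using basis by (intro the1_equality) (simp_all add: schauder_basis_def)

lemma coeff_add: "coeff (x + y) n = coeff x n + coeff y n"
proof -
  have "coeff (x + y) = (\<lambda>n. coeff x n + coeff y n)"
    using sums_add[OF coeff_sums[of x] coeff_sums[of y]]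
    by (intro coeff_unique) (simp add: scale_left_distrib)
  then show ?thesis by simp
qed

lemma coeff_smul: "coeff (smul c x) n = c * coeff x n"
proof -
  have "coeff (smul c x) = (\<lambda>n. c * coeff x n)"
    using bounded_linear.sums[OF bounded_linear_smul[of c] coeff_sums[of x]]
    by (intro coeff_unique) simp
  then show ?thesis by simp
qed

lemma e_nonzero: "e n \<noteq> 0"
proof
  assume "e n = 0"
  then have "(\<lambda>k. smul (if k = n then 1 else 0) (e k)) = (\<lambda>k. 0)"
    by (auto simp: scale_zero_left scale_zero_right)
  then have "coeff 0 = (\<lambda>k. if k = n then 1 else 0)"
    by (intro coeff_unique) simp
  moreover have "coeff 0 = (\<lambda>k. 0)"
    by (intro coeff_unique) (simp add: scale_zero_left)
  ultimately show False by (metis zero_neq_one)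
qed

definition P :: "nat \<Rightarrow> 'a \<Rightarrow> 'a" where
  "P n x = (\<Sum>k<n. smul (coeff x k) (e k))"

lemma P_add: "P n (x + y) = P n x + P n y"
  by (simp add: P_def coeff_add scale_left_distrib sum.distrib)

lemma P_smul: "P n (smul c x) = smul c (P n x)"
  by (simp add: P_def coeff_smul scale_sum_right)

lemma P_scaleR: "P n (r *\<^sub>R x) = r *\<^sub>R P n x"
  using P_smul[of n "of_real r" x] by (simp add: smul_of_real)

lemma P_linear: "Vector_Spaces.linear smul smul (P n)"
  by (simp add: linear_smul_iff P_add P_smul)

lemma P_tendsto: "(\<lambda>n. P n x) \<longlonglongrightarrow> x"
  using coeff_sums by (simp add: P_def sums_def)

lemma P_Suc: "P (Suc n) x = P n x + smul (coeff x n) (e n)"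
  by (simp add: P_def)

lemma P_0: "P 0 x = 0"
  by (simp add: P_def)

lemma coeff_sum: "coeff (\<Sum>k<n. smul (a k) (e k)) = (\<lambda>k. if k < n then a k else 0)"
proof (rule coeff_unique)
  have "(\<lambda>k. smul (if k < n then a k else 0) (e k)) sums
      (\<Sum>k<n. smul (if k < n then a k else 0) (e k))"
    by (rule sums_finite) (auto simp: scale_zero_left)
  also have "(\<Sum>k<n. smul (if k < n then a k else 0) (e k)) = (\<Sum>k<n. smul (a k) (e k))"
    by (rule sum.cong) auto
  finally show "(\<lambda>k. smul (if k < n then a k else 0) (e k)) sums (\<Sum>k<n. smul (a k) (e k))" .
qed

lemma P_sum: "P m (\<Sum>k<n. smul (a k) (e k)) = (\<Sum>k<min m n. smul (a k) (e k))"
  unfolding P_def coeff_sum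
  by (rule sum.mono_neutral_cong_right) (auto simp: scale_zero_left)

lemma P_P: "P m (P n x) = P (min m n) x"
  unfolding P_def[of n] P_sum by (simp add: P_def)

lemma P_bdd_above: "bdd_above (range (\<lambda>n. norm (P n x)))"
proof -
  have "Bseq (\<lambda>n. P n x)"
    using P_tendsto convergent_def by (intro convergent_imp_Bseq) blast
  then obtain K where "\<And>n. norm (P n x) \<le> K"
    by (auto simp: Bseq_def)
  then show ?thesis by (rule bdd_aboveI2)
qed

text \<open>The supremum of \<open>norm (P n x)\<close> over \<open>n\<close> is a finite seminorm,
  so by Zabreiko's lemma only its countable subadditivity has to be checked.\<close>

theorem P_uniformly_bounded: obtains C where "\<And>n x. norm (P n x) \<le> C * norm x" "C \<ge> 0"
proof -
  define q where "q x = (SUP n. norm (P n x))" for x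
  have P_le: "norm (P n x) \<le> q x" for n x
    unfolding q_def by (rule cSUP_upper[OF _ P_bdd_above]) simp
  have q_least: "q x \<le> c" if "\<And>n. norm (P n x) \<le> c" for c x
    unfolding q_def by (rule cSUP_least) (use that in auto)
  have q_suminf: "q s \<le> (\<Sum>j. q (x j))" if x: "x sums s" and summ: "summable (\<lambda>j. q (x j))" for x s
  proof -
    have coeff_le: "norm (coeff (x j) n) \<le> 2 * q (x j) / norm (e n)" for j n
    proof -
      have "norm (coeff (x j) n) * norm (e n) = norm (P (Suc n) (x j) - P n (x j))"
        by (simp add: P_Suc norm_smul)
      also have "\<dots> \<le> 2 * q (x j)"
        using norm_triangle_ineq4[of "P (Suc n) (x j)" "P n (x j)"] P_le[of "Suc n" "x j"]
          P_le[of n "x j"] by linarith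
      finally show ?thesis using e_nonzero[of n] by (simp add: field_simps)
    qed
    have summ_coeff: "summable (\<lambda>j. coeff (x j) n)" for n
      by (rule summable_comparison_test'[OF summable_divide[OF summable_mult[OF summ, of 2]], of 0])
        (rule coeff_le)
    \<comment> \<open>The expected coefficients of \<open>s\<close>: those of the
      \<open>x j\<close>, summed over \<open>j\<close>. Uniqueness of expansions will identify them
      with \<open>coeff s\<close>.\<close>
    define b where "b n = (\<Sum>j. coeff (x j) n)" for n
    have summ_P: "summable (\<lambda>j. P n (x j))" for n
      by (rule summable_comparison_test'[OF summ, of 0]) (rule P_le)
    have Y: "(\<Sum>k<n. smul (b k) (e k)) = (\<Sum>j. P n (x j))" for n
    proof -
      have "(\<Sum>j. P n (x j)) = (\<Sum>k<n. \<Sum>j. smul (coeff (x j) k) (e k))"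
        unfolding P_def
        by (rule suminf_sum) (rule bounded_linear.summable[OF bounded_linear_smul_left summ_coeff])
      also have "\<dots> = (\<Sum>k<n. smul (b k) (e k))"
        unfolding b_def by (simp add: bounded_linear.suminf[OF bounded_linear_smul_left summ_coeff])
      finally show ?thesis by simp
    qed
    \<comment> \<open>The limits in \<open>n\<close> and in the number of summands may be
      interchanged because \<open>q (x j)\<close> dominates \<open>P n (x j)\<close> uniformly in
      \<open>n\<close>.\<close>
    have "(\<lambda>n. \<Sum>j. P n (x j)) \<longlonglongrightarrow> s"
    proof (rule swap_uniform_limit')
      show "uniform_limit UNIV (\<lambda>J n. \<Sum>j<J. P n (x j)) (\<lambda>n. \<Sum>j. P n (x j)) sequentially"
        by (rule Weierstrass_m_test[OF _ summ]) (rule P_le)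
      show "\<forall>\<^sub>F J in sequentially. (\<lambda>n. \<Sum>j<J. P n (x j)) \<longlonglongrightarrow> (\<Sum>j<J. x j)"
        by (intro always_eventually allI tendsto_sum P_tendsto)
      show "(\<lambda>J. \<Sum>j<J. x j) \<longlonglongrightarrow> s" using x by (simp add: sums_def)
    qed auto
    then have "coeff s = b"
      by (intro coeff_unique) (simp add: sums_def Y)
    then have "P n s = (\<Sum>j. P n (x j))" for n
      by (simp add: P_def[of n s] Y)
    moreover have "norm (\<Sum>j. P n (x j)) \<le> (\<Sum>j. q (x j))" for n
      by (rule norm_suminf_le[OF P_le summ])
    ultimately show ?thesis by (intro q_least) simp
  qed
  have q_add: "q (x + y) \<le> q x + q y" for x y
    using P_le[of _ x] P_le[of _ y] by (intro q_least) (metis P_add norm_triangle_mono)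
  have q_scale: "q (c *\<^sub>R x) \<le> \<bar>c\<bar> * q x" for c x
    by (intro q_least) (simp add: P_scaleR mult_left_mono P_le)
  have q_nonneg: "0 \<le> q x" for x
    using P_le[of 0 x] by (simp add: P_0)
  obtain C where C: "\<And>x. q x \<le> C * norm x" "C \<ge> 0"
    using countably_subadditive_seminorm_bounded[of q, OF q_add q_scale q_nonneg q_suminf] by blast
  show ?thesis
    by (rule that[OF order_trans[OF P_le C(1)] C(2)])
qed

lemma P_bounded_linear: "bounded_linear (P n)"
proof -
  obtain C where "\<And>n x. norm (P n x) \<le> C * norm x" using P_uniformly_bounded by blast
  then show ?thesis
    by (intro bounded_linear_intro[where K = C]) (simp_all add: P_add P_scaleR mult.commute)
qed

lemma P_diff: "P n (x - y) = P n x - P n y"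
  using P_add[of n "x - y" y] by (simp add: algebra_simps)

lemma P_subseq_tendsto: "strict_mono M \<Longrightarrow> (\<lambda>k. P (M k) x) \<longlonglongrightarrow> x"
  using LIMSEQ_subseq_LIMSEQ[OF P_tendsto] by (simp add: o_def)

lemma Blinfun_P: "blinfun_apply (Blinfun (P n)) = P n"
  by (rule bounded_linear_Blinfun_apply[OF P_bounded_linear])

text \<open>Equivalently, \<phi> composed with \<open>P n\<close> converges to \<phi> in the norm of
  the dual space, for every \<phi> in it.\<close>

definition shrinking :: bool where
  "shrinking \<longleftrightarrow> (\<forall>\<phi>\<in>dual_space smul. \<forall>\<epsilon>>0. \<exists>n0. \<forall>n\<ge>n0. \<forall>x. norm (\<phi> (x - P n x)) \<le> \<epsilon> * norm x)"

text \<open>A tail on which \<phi> is large is truncated so late that \<phi> stays large, then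
  divided by its value under \<phi>. The truncated tail has norm at most
  \<open>C * (1 + C) * norm x\<close> and its value exceeds \<open>\<delta> * norm x\<close>, hence
  the bound.\<close>

lemma nonshrinking_block:
  assumes \<phi>: "\<phi> \<in> dual_space smul" and \<delta>: "\<delta> > 0"
    and large: "\<And>n0. \<exists>n\<ge>n0. \<exists>x. \<delta> * norm x < norm (\<phi> (x - P n x))"
    and C: "\<And>n x. norm (P n x) \<le> C * norm x" "C \<ge> 0"
  shows "\<exists>m>n. \<exists>u. P m u = u \<and> P n u = 0 \<and> \<phi> u = 1 \<and> norm u \<le> C * (1 + C) / \<delta>"
proof -
  obtain n1 x where n1: "n1 \<ge> n" and x: "\<delta> * norm x < norm (\<phi> (x - P n1 x))"
    using large by blast
  define y where "y = x - P n1 x"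
  have Py: "P n y = 0" using n1 by (simp add: y_def P_diff P_P min_absorb1)
  have "(\<lambda>m. norm (\<phi> (P m y))) \<longlonglongrightarrow> norm (\<phi> y)"
    by (intro tendsto_norm bounded_linear.tendsto[OF dual_space_bounded_linear[OF \<phi>]] P_tendsto)
  then have "\<forall>\<^sub>F m in sequentially. \<delta> * norm x < norm (\<phi> (P m y))"
    using x by (intro order_tendstoD(1)) (simp_all add: y_def)
  then have "\<forall>\<^sub>F m in sequentially. \<delta> * norm x < norm (\<phi> (P m y)) \<and> n < m"
    using eventually_gt_at_top by (rule eventually_conj)
  then obtain m where m: "\<delta> * norm x < norm (\<phi> (P m y))" "n < m"
    using eventually_happens by fastforce
  define u where "u = smul (inverse (\<phi> (P m y))) (P m y)"
  have nz: "norm (\<phi> (P m y)) > 0"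
    by (rule le_less_trans[OF _ m(1)]) (use \<delta> in simp)
  have x0: "norm x > 0"
    using nz by (auto simp: y_def P_diff dual_space_0[OF \<phi>] linear_simps[OF P_bounded_linear])
  have "P m u = u" by (simp add: u_def P_smul P_P)
  moreover have "P n u = 0" using m(2) by (simp add: u_def P_smul P_P min_absorb1 Py)
  moreover have "\<phi> u = 1" using nz by (simp add: u_def dual_space_smul[OF \<phi>])
  moreover have "norm u \<le> C * (1 + C) / \<delta>"
  proof -
    have "norm y \<le> norm x + C * norm x"
      using norm_triangle_ineq4[of x "P n1 x"] C(1)[of n1 x] by (simp add: y_def)
    then have "norm (P m y) \<le> C * ((1 + C) * norm x)"
      by (intro order_trans[OF C(1) mult_left_mono[OF _ C(2)]]) (simp add: algebra_simps)
    then have "norm u \<le> (C * ((1 + C) * norm x)) / (\<delta> * norm x)"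
      unfolding u_def norm_smul norm_inverse
      using m(1) \<delta> x0 C(2) nz
      by (simp only: divide_inverse mult.commute[of "inverse _"])
        (intro mult_mono le_imp_inverse_le, auto)
    then show ?thesis using x0 by simp
  qed
  ultimately show ?thesis using m(2) by blast
qed

theorem nonshrinking_imp_not_mean_ergodic:
  assumes "\<not> shrinking"
  shows "\<exists>T. uniformly_continuous_semigroup smul T \<and> bounded_semigroup T \<and> \<not> mean_ergodic T"
proof -
  obtain C where C: "\<And>n x. norm (P n x) \<le> C * norm x" "C \<ge> 0"
    using P_uniformly_bounded by blast
  obtain \<phi> \<delta> where \<phi>: "\<phi> \<in> dual_space smul" and \<delta>: "\<delta> > 0"
    and large: "\<And>n0. \<exists>n\<ge>n0. \<exists>x. \<delta> * norm x < norm (\<phi> (x - P n x))"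
    using assms unfolding shrinking_def not_le[symmetric] by blast
  have "\<forall>n. \<exists>m u. n < m \<and> P m u = u \<and> P n u = 0 \<and> \<phi> u = 1 \<and> norm u \<le> C * (1 + C) / \<delta>"
    using nonshrinking_block[OF \<phi> \<delta> large C] by blast
  then obtain succ u where succ: "\<And>n. n < succ n"
    and u: "\<And>n. P (succ n) (u n) = u n" "\<And>n. P n (u n) = 0" "\<And>n. \<phi> (u n) = 1"
      "\<And>n. norm (u n) \<le> C * (1 + C) / \<delta>"
    by metis
  \<comment> \<open>Each block starts where the preceding one ends, so \<open>u (M k)\<close> lies
    in the range of \<open>P (M (Suc k)) - P (M k)\<close>; starting at 0 makes the first projection
    zero.\<close>
  define M where "M k = (succ ^^ k) 0" for k
  have M_Suc: "M (Suc k) = succ (M k)" for k by (simp add: M_def)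
  have M: "strict_mono M" by (simp add: strict_mono_Suc_iff M_Suc succ)
  interpret nonshrinking_projections smul "\<lambda>k. Blinfun (P (M k))" "\<lambda>k. u (M k)" \<phi>
    "max C (C * (1 + C) / \<delta>)"
  proof (intro nonshrinking_projections.intro nonshrinking_projections_axioms.intro banach_space_over_axioms)
    show "Vector_Spaces.linear smul smul (Blinfun (P (M n)))" for n
      by (simp add: Blinfun_P P_linear)
    show "norm (Blinfun (P (M n))) \<le> max C (C * (1 + C) / \<delta>)" for n
      using norm_blinfun_bound[OF C(2), of "Blinfun (P (M n))"] C(1) by (simp add: Blinfun_P le_max_iff_disj)
    show "Blinfun (P (M m)) (Blinfun (P (M n)) x) = Blinfun (P (M (min m n))) x" for m n x
      by (simp add: Blinfun_P P_P min_of_mono[OF strict_mono_mono[OF M]])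
    show "Blinfun (P (M 0)) x = 0" for x by (simp add: Blinfun_P P_0 M_def)
    show "x = 0" if "\<And>n. Blinfun (P (M n)) x = 0" for x
      using P_subseq_tendsto[OF M, of x] that by (simp add: Blinfun_P LIMSEQ_const_iff)
    show "norm (u (M n)) \<le> max C (C * (1 + C) / \<delta>)" for n
      using u(4) by (simp add: le_max_iff_disj)
    show "Blinfun (P (M (Suc n))) (u (M n)) = u (M n)" for n
      by (simp add: Blinfun_P M_Suc u)
    show "Blinfun (P (M n)) (u (M n)) = 0" for n
      by (simp add: Blinfun_P u)
  qed (simp_all add: \<phi> u)
  show ?thesis using T_semigroup T_bounded not_mean_ergodic by blast
qed

section \<open>Expansions of bidual functionals\<close>

lemma coeff_dual: "(\<lambda>x. coeff x k) \<in> dual_space smul"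
proof -
  obtain C where C: "\<And>n x. norm (P n x) \<le> C * norm x" "C \<ge> 0"
    using P_uniformly_bounded by blast
  show ?thesis
  proof (rule dual_spaceI)
    show "norm (coeff x k) \<le> norm x * (2 * C / norm (e k))" for x
    proof -
      have "norm (coeff x k) * norm (e k) = norm (P (Suc k) x - P k x)"
        by (simp add: P_Suc norm_smul)
      also have "\<dots> \<le> norm x * (2 * C)"
        using norm_triangle_ineq4[of "P (Suc k) x" "P k x"] C(1)[of "Suc k" x] C(1)[of k x]
        by (simp add: mult_ac)
      finally show ?thesis using e_nonzero[of k] by (simp add: field_simps)
    qed
  qed (simp_all add: coeff_add coeff_smul)
qed

text \<open>For \<open>F\<close> in the bidual, this vector represents the second adjoint of
  \<open>P n\<close> applied to \<open>F\<close>; see \<open>dual_bidual_sum\<close>.\<close>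

definition bidual_sum :: "(('a \<Rightarrow> 'k) \<Rightarrow> 'k) \<Rightarrow> nat \<Rightarrow> 'a" where
  "bidual_sum F n = (\<Sum>k<n. smul (F (\<lambda>x. coeff x k)) (e k))"

lemma P_bidual_sum: "P m (bidual_sum F n) = bidual_sum F (min m n)"
  by (simp add: bidual_sum_def P_sum)

lemma dual_bidual_sum:
  assumes F: "F \<in> bidual_space smul" and \<phi>: "\<phi> \<in> dual_space smul"
  shows "\<phi> (bidual_sum F n) = F (\<lambda>x. \<phi> (P n x))"
proof (induction n)
  case 0
  show ?case
    using bidual_space_times[OF F \<phi>, of 0] dual_space_0[OF \<phi>] by (simp add: bidual_sum_def P_0)
next
  case (Suc n)
  have P\<phi>: "(\<lambda>x. \<phi> (P n x)) \<in> dual_space smul"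
    by (rule dual_space_compose[OF \<phi> P_linear P_bounded_linear])
  have "F (\<lambda>x. \<phi> (P (Suc n) x)) = F (\<lambda>x. \<phi> (P n x) + \<phi> (e n) * coeff x n)"
    by (simp add: P_Suc dual_space_add[OF \<phi>] dual_space_smul[OF \<phi>] mult.commute)
  also have "\<dots> = F (\<lambda>x. \<phi> (P n x)) + F (\<lambda>x. \<phi> (e n) * coeff x n)"
    by (rule bidual_space_add[OF F P\<phi> dual_space_times[OF coeff_dual]])
  also have "F (\<lambda>x. \<phi> (e n) * coeff x n) = \<phi> (e n) * F (\<lambda>x. coeff x n)"
    by (rule bidual_space_times[OF F coeff_dual])
  finally show ?case
    using Suc by (simp add: bidual_sum_def dual_space_add[OF \<phi>] dual_space_smul[OF \<phi>] mult.commute)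
qed

lemma bidual_bound:
  assumes "F \<in> bidual_space smul"
  obtains B where "B \<ge> 0"
    "\<And>\<phi> c. \<phi> \<in> dual_space smul \<Longrightarrow> (\<And>x. norm (\<phi> x) \<le> c * norm x) \<Longrightarrow> c \<ge> 0 \<Longrightarrow> norm (F \<phi>) \<le> B * c"
proof -
  obtain B where B: "\<And>\<phi>. \<phi> \<in> dual_space smul \<Longrightarrow> norm (F \<phi>) \<le> B * onorm \<phi>"
    using assms unfolding bidual_space_def by blast
  show ?thesis
  proof (rule that)
    fix \<phi> and c :: real
    assume \<phi>: "\<phi> \<in> dual_space smul" and c: "\<And>x. norm (\<phi> x) \<le> c * norm x" "c \<ge> 0"
    have "norm (F \<phi>) \<le> B * onorm \<phi>" by (rule B[OF \<phi>])
    also have "\<dots> \<le> \<bar>B\<bar> * c"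
      using onorm_bound[OF c(2,1)] onorm_pos_le[OF dual_space_bounded_linear[OF \<phi>]]
      by (intro mult_mono) auto
    finally show "norm (F \<phi>) \<le> \<bar>B\<bar> * c" .
  qed simp
qed

text \<open>A functional of norm at most 4 attains the norm of the vector as its value there. That
  value is \<open>F\<close> at its composition with \<open>P n\<close>, whose norm is at most
  \<open>4 * C\<close>.\<close>

lemma bidual_sum_bounded:
  assumes F: "F \<in> bidual_space smul"
  obtains K where "\<And>n. norm (bidual_sum F n) \<le> K"
proof -
  obtain C where C: "\<And>n x. norm (P n x) \<le> C * norm x" "C \<ge> 0"
    using P_uniformly_bounded by blast
  obtain B where B: "\<And>\<phi> c. \<phi> \<in> dual_space smul \<Longrightarrow> (\<And>x. norm (\<phi> x) \<le> c * norm x) \<Longrightarrow> c \<ge> 0 \<Longrightarrow>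
      norm (F \<phi>) \<le> B * c"
    using bidual_bound[OF F] by blast
  have "norm (bidual_sum F n) \<le> B * (4 * C)" for n
  proof -
    obtain \<phi> where \<phi>: "\<phi> \<in> dual_space smul" "\<And>x. norm (\<phi> x) \<le> 4 * norm x"
      "\<phi> (bidual_sum F n) = of_real (norm (bidual_sum F n))"
      using hahn_banach_seminorm[OF seminorm_norm] by blast
    have "norm (F (\<lambda>x. \<phi> (P n x))) \<le> B * (4 * C)"
    proof (rule B)
      show "(\<lambda>x. \<phi> (P n x)) \<in> dual_space smul"
        by (rule dual_space_compose[OF \<phi>(1) P_linear P_bounded_linear])
      show "norm (\<phi> (P n x)) \<le> 4 * C * norm x" for x
        using \<phi>(2)[of "P n x"] C(1)[of n x] by simp
    qed (use C in simp)
    then show ?thesis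
      using dual_bidual_sum[OF F \<phi>(1), of n] \<phi>(3) by (metis abs_norm_cancel norm_of_real)
  qed
  then show ?thesis by (rule that)
qed

text \<open>Shrinking makes \<phi> composed with \<open>P n\<close> converge to \<phi> in norm, and
  \<open>F\<close> is norm continuous, so the values of \<phi> on the partial sums tend to
  \<open>F \<phi>\<close>.\<close>

lemma bidual_sum_limit:
  assumes F: "F \<in> bidual_space smul" and \<phi>: "\<phi> \<in> dual_space smul"
    and shrinking and lim: "bidual_sum F \<longlonglongrightarrow> x"
  shows "F \<phi> = \<phi> x"
proof (rule LIMSEQ_unique)
  show "(\<lambda>n. \<phi> (bidual_sum F n)) \<longlonglongrightarrow> \<phi> x"
    by (rule bounded_linear.tendsto[OF dual_space_bounded_linear[OF \<phi>] lim])
  obtain B where "B \<ge> 0" and B: "\<And>\<phi> c. \<phi> \<in> dual_space smul \<Longrightarrow> (\<And>x. norm (\<phi> x) \<le> c * norm x) \<Longrightarrow> c \<ge> 0 \<Longrightarrow>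
      norm (F \<phi>) \<le> B * c"
    using bidual_bound[OF F] by blast
  show "(\<lambda>n. \<phi> (bidual_sum F n)) \<longlonglongrightarrow> F \<phi>"
  proof (rule LIMSEQ_I)
    fix r :: real assume r: "r > 0"
    define \<epsilon> where "\<epsilon> = r / (2 * (B + 1))"
    have \<epsilon>: "\<epsilon> > 0" "B * \<epsilon> < r" using r \<open>B \<ge> 0\<close> by (auto simp: \<epsilon>_def field_simps add_nonneg_pos)
    obtain n0 where n0: "\<And>n x. n \<ge> n0 \<Longrightarrow> norm (\<phi> (x - P n x)) \<le> \<epsilon> * norm x"
      using \<open>shrinking\<close> \<phi> \<epsilon>(1) unfolding shrinking_def by blast
    have "norm (\<phi> (bidual_sum F n) - F \<phi>) < r" if "n \<ge> n0" for n
    proof -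
      have P\<phi>: "(\<lambda>x. \<phi> (P n x)) \<in> dual_space smul"
        by (rule dual_space_compose[OF \<phi> P_linear P_bounded_linear])
      have "norm (F (\<lambda>x. \<phi> x - \<phi> (P n x))) \<le> B * \<epsilon>"
        using n0[OF that] \<epsilon>(1)
        by (intro B dual_space_minus \<phi> P\<phi>) (simp_all add: dual_space_diff[OF \<phi>])
      then show ?thesis
        using \<epsilon>(2) by (simp add: bidual_space_diff[OF F \<phi> P\<phi>] dual_bidual_sum[OF F \<phi>] norm_minus_commute)
    qed
    then show "\<exists>n0. \<forall>n\<ge>n0. norm (\<phi> (bidual_sum F n) - F \<phi>) < r" by blast
  qed
qed

text \<open>If the basis is shrinking but the space is not reflexive, then the expansion of some bidual
  functional is bounded and divergent. Replacing the partial sum projections by those of a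
  basis whose vectors are sparse partial sums of that expansion (as for the summing basis of
  the space of null sequences) gives a nonshrinking system.\<close>

theorem shrinking_imp_not_mean_ergodic:
  assumes shr: shrinking and "\<not> reflexive_space smul"
  shows "\<exists>T. uniformly_continuous_semigroup smul T \<and> bounded_semigroup T \<and> \<not> mean_ergodic T"
proof -
  obtain C where C: "\<And>n x. norm (P n x) \<le> C * norm x" "C \<ge> 0"
    using P_uniformly_bounded by blast
  obtain F where F: "F \<in> bidual_space smul"
    and nonrefl: "\<And>x. \<exists>\<phi>\<in>dual_space smul. F \<phi> \<noteq> \<phi> x"
    using assms(2) unfolding reflexive_space_def by blast
  define v where "v = bidual_sum F"
  obtain V where V: "\<And>n. norm (v n) \<le> V" using bidual_sum_bounded[OF F] unfolding v_def by blast
  have Pv: "P m (v n) = v (min m n)" for m n by (simp add: v_def P_bidual_sum)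
  have "\<not> Cauchy v"
  proof
    assume "Cauchy v"
    then obtain x where "v \<longlonglongrightarrow> x" using Cauchy_convergent convergent_def by blast
    then show False using nonrefl[of x] bidual_sum_limit[OF F _ shr] by (auto simp: v_def)
  qed
  then obtain \<delta> where \<delta>: "\<delta> > 0" "\<And>N. \<exists>m>N. \<delta> \<le> norm (v m - v N)"
    using not_Cauchy_jump[of v] unfolding dist_norm by blast
  then obtain succ where succ: "\<And>n. n < succ n" "\<And>n. \<delta> \<le> norm (v (succ n) - v n)" by metis
  define M where "M k = (succ ^^ k) 0" for k
  have M_Suc: "M (Suc k) = succ (M k)" for k by (simp add: M_def)
  have M: "strict_mono M" by (simp add: strict_mono_Suc_iff M_Suc succ)
  have M_le: "M i \<le> M j \<longleftrightarrow> i \<le> j" for i j using M by (simp add: strict_mono_less_eq)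
  define w where "w k = v (M k)" for k
  have w_gap: "\<delta> \<le> norm (w (Suc k) - w k)" for k by (simp add: w_def M_Suc succ)
  have Pw: "P (M i) (w j) = w (min i j)" for i j
    by (simp add: w_def Pv min_of_mono[OF strict_mono_mono[OF M]])
  have PP: "P (M i) (P (M j) x) = P (M (min i j)) x" for i j x
    by (simp add: P_P min_of_mono[OF strict_mono_mono[OF M]])
  \<comment> \<open>A Hahn-Banach functional is normalised on each increment; the lower bound
    \<delta> for the increments keeps the norms uniformly bounded.\<close>
  have "\<exists>h. h \<in> dual_space smul \<and> (\<forall>x. norm (h x) \<le> 4 / \<delta> * norm x) \<and> h (w (Suc k) - w k) = 1" for k
  proof -
    let ?a = "w (Suc k) - w k"
    obtain \<phi> where \<phi>: "\<phi> \<in> dual_space smul" "\<And>x. norm (\<phi> x) \<le> 4 * norm x" "\<phi> ?a = of_real (norm ?a)"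
      using hahn_banach_seminorm[OF seminorm_norm] by blast
    let ?h = "\<lambda>x. of_real (inverse (norm ?a)) * \<phi> x"
    have "?h \<in> dual_space smul" by (rule dual_space_times[OF \<phi>(1)])
    moreover have "norm (?h x) \<le> 4 / \<delta> * norm x" for x
    proof -
      have "inverse (norm ?a) * norm (\<phi> x) \<le> inverse \<delta> * (4 * norm x)"
        using w_gap[of k] \<delta>(1) \<phi>(2) by (intro mult_mono le_imp_inverse_le) auto
      then show ?thesis by (simp add: norm_mult norm_inverse divide_inverse mult_ac)
    qed
    moreover have "?h ?a = 1"
    proof -
      have "norm ?a \<noteq> 0" using w_gap[of k] \<delta>(1) by linarith
      then show ?thesis unfolding \<phi>(3) of_real_mult[symmetric] left_inverse[OF \<open>norm ?a \<noteq> 0\<close>] by simp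
    qed
    ultimately show ?thesis by blast
  qed
  then obtain h where h: "\<And>k. h k \<in> dual_space smul" "\<And>k x. norm (h k x) \<le> 4 / \<delta> * norm x"
    "\<And>k. h k (w (Suc k) - w k) = 1" by metis
  \<comment> \<open>Composition with the block projection makes \<open>g k\<close> see only block
    \<open>k\<close>: its value at \<open>w j\<close> is 1 for j > k and 0 for j <= k.\<close>
  define g where "g k x = h k (P (M (Suc k)) x - P (M k) x)" for k x
  have g_dual: "g k \<in> dual_space smul" for k
    unfolding g_def
    by (rule dual_space_compose[OF h(1)])
      (auto simp: linear_smul_iff P_add P_smul scale_right_diff_distrib intro: bounded_linear_sub P_bounded_linear)
  note g_diff = dual_space_diff[OF g_dual] and g_smul = dual_space_smul[OF g_dual]
  let ?B = "4 / \<delta> * (2 * C)"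
  have g_le: "norm (g k x) \<le> ?B * norm x" for k x
  proof -
    have "norm (P (M (Suc k)) x - P (M k) x) \<le> 2 * C * norm x"
      using norm_triangle_ineq4[of "P (M (Suc k)) x" "P (M k) x"] C(1)[of "M (Suc k)" x] C(1)[of "M k" x]
      by simp
    then have "4 / \<delta> * norm (P (M (Suc k)) x - P (M k) x) \<le> 4 / \<delta> * (2 * C * norm x)"
      using \<delta>(1) by (intro mult_left_mono) auto
    then show ?thesis unfolding g_def using h(2) order_trans by (fastforce simp: mult.assoc)
  qed
  have g_P_less: "g k (P (M j) x) = g k x" if "k < j" for j k x
    using that by (simp add: g_def PP min_absorb1)
  have g_P_ge: "g k (P (M j) x) = 0" if "j \<le> k" for j k x
    using that dual_space_0[OF h(1)] by (simp add: g_def PP min_absorb2)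
  have g_w_less: "g k (w j) = 1" if "k < j" for j k
    using that h(3) by (simp add: g_def Pw min_absorb1)
  have g_w_ge: "g k (w j) = 0" if "j \<le> k" for j k
    using g_P_ge[OF that, of "w j"] by (simp add: Pw)
  \<comment> \<open>The correction term makes \<open>R k\<close> fix \<open>w j\<close> for j <= k
    and annihilate it for j > k, as the partial sum projections of a basis containing the
    \<open>w j\<close> would.\<close>
  define R where "R k x = P (M k) x - smul (g k x) (w k)" for k x
  have R_bl: "bounded_linear (R k)" for k
    unfolding R_def
    by (intro bounded_linear_sub P_bounded_linear bounded_linear_compose[OF bounded_linear_smul_left]
        dual_space_bounded_linear[OF g_dual])
  note R_apply = bounded_linear_Blinfun_apply[OF R_bl]
  have R_R: "R m (R n x) = R (min m n) x" for m n x
  proof (cases "n \<le> m")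
    case True
    have "P (M m) (R n x) = R n x"
      using True by (simp add: R_def P_diff P_smul PP Pw min_absorb2)
    moreover have "g m (R n x) = 0"
      using True by (simp add: R_def g_diff g_smul g_P_ge g_w_ge)
    ultimately show ?thesis using True by (simp add: R_def[of m] scale_zero_left min_absorb2)
  next
    case False
    have "P (M m) (R n x) = P (M m) x - smul (g n x) (w m)"
      using False by (simp add: R_def P_diff P_smul PP Pw min_absorb1)
    moreover have "g m (R n x) = g m x - g n x"
      using False by (simp add: R_def g_diff g_smul g_P_less g_w_less)
    ultimately show ?thesis
      using False by (simp add: R_def[of m] scale_left_diff_distrib min_absorb1)
  qed
  have V0: "V \<ge> 0" using V[of 0] norm_ge_zero[of "v 0"] by linarith
  \<comment> \<open>The vectors are shifted by one because \<open>w 0 = 0\<close>; the single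
    functional \<open>g 0\<close> equals 1 on every \<open>w (Suc k)\<close>.\<close>
  interpret nonshrinking_projections smul "\<lambda>k. Blinfun (R k)" "\<lambda>k. w (Suc k)" "g 0" "C + ?B * V + V"
  proof (intro nonshrinking_projections.intro nonshrinking_projections_axioms.intro banach_space_over_axioms)
    show "Vector_Spaces.linear smul smul (Blinfun (R n))" for n
      by (simp add: R_apply linear_smul_iff R_def P_add P_smul dual_space_add[OF g_dual] g_smul
          scale_left_distrib scale_right_diff_distrib algebra_simps)
    show "norm (Blinfun (R n)) \<le> C + ?B * V + V" for n
    proof (rule norm_blinfun_bound)
      show "0 \<le> C + ?B * V + V" using C(2) V0 \<delta>(1) by simp
      fix x
      have "norm (smul (g n x) (w n)) \<le> (?B * norm x) * V"
        unfolding norm_smul using g_le[of n x] V C(2) \<delta>(1) by (intro mult_mono) (auto simp: w_def)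
      moreover have "0 \<le> V * norm x" using V0 by simp
      ultimately show "norm (Blinfun (R n) x) \<le> (C + ?B * V + V) * norm x"
        using norm_triangle_ineq4[of "P (M n) x" "smul (g n x) (w n)"] C(1)[of "M n" x]
        by (simp add: R_apply R_def algebra_simps)
    qed
    show "Blinfun (R m) (Blinfun (R n) x) = Blinfun (R (min m n)) x" for m n x
      by (simp add: R_apply R_R)
    show "Blinfun (R 0) x = 0" for x
      by (simp add: R_apply R_def M_def w_def v_def bidual_sum_def P_0 scale_zero_right)
    show "x = 0" if "\<And>n. Blinfun (R n) x = 0" for x
    proof -
      \<comment> \<open>If all \<open>R n x\<close> vanish, the partial sums of \<open>x\<close> are
        multiples of the \<open>w n\<close>. Applying \<open>g 0\<close> shows that from index 1 on
        the factor is the constant \<open>?c\<close>. The partial sums converge but the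
        \<open>w n\<close> keep jumping by \<delta>, so \<open>?c\<close> is 0.\<close>
      let ?c = "g 0 x"
      have P: "P (M n) x = smul (g n x) (w n)" for n using that[of n] by (simp add: R_apply R_def)
      have "g (Suc n) x = ?c" for n
        using g_P_less[of 0 "Suc n" x] by (simp add: P g_smul g_w_less)
      then have P': "P (M (Suc n)) x = smul ?c (w (Suc n))" for n by (simp add: P)
      have lim: "(\<lambda>n. P (M (Suc n)) x) \<longlonglongrightarrow> x"
        by (rule LIMSEQ_Suc[OF P_subseq_tendsto[OF M]])
      have "(\<lambda>n. norm (P (M (Suc (Suc n))) x - P (M (Suc n)) x)) \<longlonglongrightarrow> norm (x - x)"
        by (intro tendsto_intros lim LIMSEQ_Suc[OF lim])
      then have "(\<lambda>n. norm ?c * norm (w (Suc (Suc n)) - w (Suc n))) \<longlonglongrightarrow> 0"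
        by (simp only: P' scale_right_diff_distrib[symmetric] norm_smul) simp
      then have "norm ?c * \<delta> \<le> 0"
        by (rule LIMSEQ_le_const) (use w_gap in \<open>auto intro!: mult_left_mono\<close>)
      then have "?c = 0" using \<delta>(1) by (simp add: mult_le_0_iff)
      then show "x = 0" using lim by (simp add: P' scale_zero_left LIMSEQ_const_iff)
    qed
    show "norm (w (Suc n)) \<le> C + ?B * V + V" for n
    proof -
      have "0 \<le> C + ?B * V" using C(2) V0 \<delta>(1) by simp
      then show ?thesis using V[of "M (Suc n)"] unfolding w_def by linarith
    qed
    show "Blinfun (R (Suc n)) (w (Suc n)) = w (Suc n)" for n
      by (simp add: R_apply R_def Pw g_w_ge scale_zero_left)
    show "Blinfun (R n) (w (Suc n)) = 0" for n
      by (simp add: R_apply R_def Pw g_w_less)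
  qed (simp_all add: g_dual g_w_less)
  show ?thesis using T_semigroup T_bounded not_mean_ergodic by blast
qed

end

section \<open>The equivalences\<close>

theorem theorem3p4:
  fixes smul :: "'k::real_or_complex_field \<Rightarrow> 'a::banach \<Rightarrow> 'a"
  assumes "banach_space_over smul"
    and "has_basis smul"
  shows "(reflexive_space smul \<longleftrightarrow>
            (\<forall>T. strongly_continuous_semigroup smul T \<and> bounded_semigroup T \<longrightarrow> mean_ergodic T)) \<and>
         (reflexive_space smul \<longleftrightarrow>
            (\<forall>T. uniformly_continuous_semigroup smul T \<and> bounded_semigroup T \<longrightarrow> mean_ergodic T))"
proof -
  interpret banach_space_over smul by fact
  have a_b: "mean_ergodic T"
    if "reflexive_space smul" "strongly_continuous_semigroup smul T" "bounded_semigroup T" for T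
  proof -
    interpret bounded_C0_semigroup smul T using that by unfold_locales
    show ?thesis by (rule reflexive_imp_mean_ergodic[OF that(1)])
  qed
  have c_a: "reflexive_space smul"
    if c: "\<forall>T. uniformly_continuous_semigroup smul T \<and> bounded_semigroup T \<longrightarrow> mean_ergodic T"
    using assms(2) unfolding has_basis_def
  proof (elim disjE exE)
    fix B assume "finite_dimensional_vector_space smul B"
    then show ?thesis by (rule finite_dimensional_imp_reflexive)
  next
    fix e assume "schauder_basis smul e"
    then interpret schauder_basis_space smul e by unfold_locales
    \<comment> \<open>By contraposition: on a nonreflexive space, a shrinking basis and a
      nonshrinking one each yield a semigroup that contradicts \<open>c\<close>.\<close>
    show ?thesis
      using c nonshrinking_imp_not_mean_ergodic shrinking_imp_not_mean_ergodic by blast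
  qed
  \<comment> \<open>Uniformly continuous semigroups are strongly continuous, so (b) implies (c),
    which closes the cycle.\<close>
  show ?thesis
    using a_b c_a by (auto simp: uniformly_continuous_semigroup_def)
qed

end
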